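(* There is an absolute constant $c>0$ such that the following holds. Let $N\ge1$ and let $A,B,C\subset[N]=\{1,\ldots,N\}$ be nonempty sets of densities $\alpha=|A|/N$, $\beta=|B|/N$, $\gamma=|C|/N$. Then $A+B+C$ contains $X+P$, where $X\subset B$ has $|X|\ge0.99|B|$ and $P$ is an arithmetic progression of length at least \[ \exp\left(c\left(\frac{\log N}{\log^3(2/\alpha\gamma)}\right)^{1/2}-\log(1/\alpha\beta\gamma)\right). \]
   Context: $A+B+C=\{a+b+c:a\in A,b\in B,c\in C\}$ and $X+P=\{x+p:x\in X,p\in P\}$. The length of an arithmetic progression is its number of terms. *)

theory Defs
  imports Complex_Main "HOL-Library.Set_Algebras"
begin

text \<open>Sumsets are the pointwise sums of sets from \<open>Set_Algebras\<close>, taken in the integers.\<close>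

text \<open>
  \<open>is_AP P k\<close>: the set \<open>P\<close> is an arithmetic progression with \<open>k\<close> terms. The common difference
  is nonzero (positive without loss of generality), so the terms are distinct and
  \<open>k\<close> is the cardinality of \<open>P\<close>.
\<close>
definition is_AP :: "int set \<Rightarrow> nat \<Rightarrow> bool" where
  "is_AP P k \<longleftrightarrow> (\<exists>a d :: int. d > 0 \<and> P = {a + int i * d | i. i < k})"

end

theory Submission
  imports Defs "HOL-Analysis.Kronecker_Approximation_Theorem" "HOL-Analysis.Harmonic_Numbers"
begin

text \<open>
  Choose \<open>z\<close> with many representations in \<open>A + C\<close> and put \<open>A' = A \<inter> (z - C)\<close>, of density at least about
  \<open>\<alpha>\<gamma>\<close>. The convolution \<open>F\<close> of the indicator function of \<open>B + C\<close> with the uniform measure on \<open>A'\<close> equals 1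
  on \<open>z + B\<close> and is supported in \<open>A + B + C\<close>, so it suffices that \<open>F\<close> changes little, at most points, under
  the shifts \<open>0, s, \<dots>, (k - 1) s\<close> for some \<open>s\<close>. By Croot-Sisask sampling, \<open>F\<close> is almost invariant, outside an
  exceptional set of density about \<open>\<beta>/k\<close>, under shifts by differences of a set \<open>T\<close>. Averaging over such shifts
  \<open>l \<sim> log (2/\<alpha>\<gamma>)\<close> times damps all frequencies outside the large spectrum of \<open>T\<close>; by Chang's theorem that
  spectrum is spanned by \<open>O(log (k/\<beta>) log\<^sup>3 (2/\<alpha>\<gamma>))\<close> frequencies, and Dirichlet's theorem supplies \<open>s\<close>.
  Almost invariance is recorded through the size of exceptional sets rather than through \<open>L\<^sup>p\<close> norms.
\<close>

section \<open>Fourier analysis on cyclic groups\<close>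

text \<open>Functions on the cyclic group of order \<open>M\<close> are modelled as functions on
  \<open>int\<close> invariant under reduction mod \<open>M\<close>, and
  \<open>echar M (r * x)\<close> is the value at \<open>x\<close> of the character with frequency
  \<open>r\<close>. For \<open>M = 0\<close> division by zero makes it constantly 1.\<close>

definition echar :: "nat \<Rightarrow> int \<Rightarrow> complex" where
  "echar M k = cis (2 * pi * (of_int k / of_nat M))"

lemma echar_add: "echar M (j + k) = echar M j * echar M k"
  by (simp add: echar_def cis_mult add_divide_distrib distrib_left)

lemma echar_0 [simp]: "echar M 0 = 1"
  by (simp add: echar_def)

lemma norm_echar [simp]: "norm (echar M k) = 1"
  by (simp add: echar_def)

lemma cnj_echar: "cnj (echar M k) = echar M (- k)"
  by (simp add: echar_def cis_cnj)

lemma echar_sum: "finite S \<Longrightarrow> echar M (sum f S) = (\<Prod>i\<in>S. echar M (f i))"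
  by (induction S rule: finite_induct) (auto simp: echar_add)

lemma echar_eq_1_iff:
  assumes "M > 0"
  shows "echar M k = 1 \<longleftrightarrow> int M dvd k"
proof
  assume "echar M k = 1"
  hence "cos (2 * pi * (of_int k / of_nat M)) = 1"
    by (simp add: echar_def complex_eq_iff)
  then obtain j :: int where "2 * pi * (of_int k / of_nat M) = of_int j * 2 * pi"
    unfolding cos_one_2pi_int by blast
  hence "real_of_int k = of_int (j * int M)"
    using assms by (simp add: field_simps)
  thus "int M dvd k" by (simp only: of_int_eq_iff) simp
next
  assume "int M dvd k"
  then obtain j where "k = int M * j" by blast
  thus "echar M k = 1" using assms by (simp add: echar_def)
qed

lemma echar_periodic: "echar M (r * (x mod int M)) = echar M (r * x)"
proof (cases "M = 0")
  case False
  have "r * x = r * (x mod int M) + int M * (r * (x div int M))"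
    by (metis mod_mult_div_eq distrib_left mult.left_commute)
  moreover have "echar M (int M * (r * (x div int M))) = 1"
    using False by (subst echar_eq_1_iff) auto
  ultimately show ?thesis by (metis echar_add mult.right_neutral)
qed simp

text \<open>The distance of a character value from 1 behaves like a seminorm in the argument: it is
  subadditive and even. All Bohr set estimates below rest on this.\<close>

lemma norm_echar_diff_1_add:
  "norm (echar M (j + k) - 1) \<le> norm (echar M j - 1) + norm (echar M k - 1)"
proof -
  have "echar M (j + k) - 1 = echar M j * (echar M k - 1) + (echar M j - 1)"
    by (simp add: echar_add algebra_simps)
  hence "norm (echar M (j + k) - 1) \<le> norm (echar M j * (echar M k - 1)) + norm (echar M j - 1)"
    by (metis norm_triangle_ineq)
  thus ?thesis by (simp add: norm_mult)
qed

lemma norm_echar_diff_1_uminus: "norm (echar M (- k) - 1) = norm (echar M k - 1)"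
  by (metis cnj_echar complex_cnj_diff complex_cnj_one complex_mod_cnj)

lemma norm_echar_diff_1_sum:
  "finite S \<Longrightarrow> norm (echar M (sum f S) - 1) \<le> (\<Sum>i\<in>S. norm (echar M (f i) - 1))"
proof (induction S rule: finite_induct)
  case (insert i S)
  have "norm (echar M (sum f (insert i S)) - 1) = norm (echar M (f i + sum f S) - 1)"
    using insert by simp
  also have "\<dots> \<le> norm (echar M (f i) - 1) + norm (echar M (sum f S) - 1)"
    by (rule norm_echar_diff_1_add)
  finally show ?case using insert by simp
qed simp

lemma norm_echar_diff_1_mult_nat: "norm (echar M (int j * k) - 1) \<le> real j * norm (echar M k - 1)"
  using norm_echar_diff_1_sum[of "{..<j}" M "\<lambda>_. k"] by simp

text \<open>Removing \<open>p\<close> full turns does not change the character, and a chord is no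
  longer than its arc. The integer \<open>p\<close> is left free so that it can come from
  Dirichlet's theorem.\<close>

lemma norm_echar_diff_1_le:
  assumes "M > 0"
  shows "norm (echar M k - 1) \<le> 2 * pi * \<bar>of_int k / of_nat M - of_int p\<bar>"
proof -
  define t where "t = 2 * pi * (of_int k / of_nat M - of_int p :: real)"
  have "echar M k = echar M (k - int M * p) * echar M (int M * p)"
    by (simp flip: echar_add)
  also have "echar M (int M * p) = 1" using assms by (subst echar_eq_1_iff) auto
  also have "echar M (k - int M * p) = exp (\<i> * of_real t)"
    using assms by (simp add: echar_def t_def cis_conv_exp diff_divide_distrib)
  finally have "norm (echar M k - 1) = 2 * \<bar>sin (t / 2)\<bar>"
    by (simp add: dist_exp_i_1)
  also have "\<dots> \<le> 2 * \<bar>t / 2\<bar>" using abs_sin_x_le_abs_x[of "t/2"] by linarith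
  also have "\<dots> = 2 * pi * \<bar>of_int k / of_nat M - of_int p\<bar>" by (simp add: t_def abs_mult)
  finally show ?thesis .
qed

section \<open>Orthogonality, Fourier inversion and Parseval\<close>

lemma sum_shift_periodic:
  fixes f :: "int \<Rightarrow> 'a::comm_monoid_add"
  assumes per: "\<And>x. f (x mod int M) = f x"
  shows "(\<Sum>x\<in>{0..<int M}. f (x + t)) = (\<Sum>x\<in>{0..<int M}. f x)"
proof (cases "M = 0")
  case False
  show ?thesis
  proof (rule sum.reindex_bij_witness[of _ "\<lambda>x. (x - t) mod int M" "\<lambda>x. (x + t) mod int M"])
    fix a assume a: "a \<in> {0..<int M}"
    have "((a + t) mod int M - t) mod int M = a mod int M"
      by (simp add: mod_diff_left_eq)
    thus "((a + t) mod int M - t) mod int M = a" using a by simp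
    have "((a - t) mod int M + t) mod int M = a mod int M"
      by (simp add: mod_add_left_eq)
    thus "((a - t) mod int M + t) mod int M = a" using a by simp
    show "(a + t) mod int M \<in> {0..<int M}" "(a - t) mod int M \<in> {0..<int M}"
      using False by auto
    show "f ((a + t) mod int M) = f (a + t)" by (rule per)
  qed
qed simp

lemma sum_echar:
  assumes "M > 0"
  shows "(\<Sum>x\<in>{0..<int M}. echar M (k * x)) = (if int M dvd k then of_nat M else 0)"
proof (cases "int M dvd k")
  case True
  hence "echar M (k * x) = 1" for x using assms by (subst echar_eq_1_iff) auto
  thus ?thesis using True by simp
next
  case False
  let ?S = "\<Sum>x\<in>{0..<int M}. echar M (k * x)"
  \<comment> \<open>Shifting the variable by 1 preserves the sum but multiplies it by
    \<open>echar M k\<close>, which differs from 1; hence the sum vanishes.\<close>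
  have "?S = (\<Sum>x\<in>{0..<int M}. echar M (k * (x + 1)))"
    by (rule sum_shift_periodic[symmetric]) (rule echar_periodic)
  also have "\<dots> = ?S * echar M k"
    by (simp add: sum_distrib_right distrib_left echar_add)
  finally have "?S * (echar M k - 1) = 0" by (simp add: algebra_simps)
  moreover have "echar M k \<noteq> 1" using False assms by (simp add: echar_eq_1_iff)
  ultimately show ?thesis using False by simp
qed

lemma eq_if_dvd_diff:
  assumes "x \<in> {0..<int M}" "y \<in> {0..<int M}" "int M dvd x - y"
  shows "x = y"
  using assms by (metis atLeastLessThan_iff mod_eq_dvd_iff mod_pos_pos_trivial)

lemma fourier_inversion:
  fixes f :: "int \<Rightarrow> complex"
  assumes M: "M > 0" and per: "\<And>x. f (x mod int M) = f x"
  shows "f x = (\<Sum>r\<in>{0..<int M}. (\<Sum>y\<in>{0..<int M}. f y * echar M (- r * y)) / of_nat M * echar M (r * x))"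
proof -
  have "(\<Sum>r\<in>{0..<int M}. (\<Sum>y\<in>{0..<int M}. f y * echar M (- r * y)) * echar M (r * x))
      = (\<Sum>r\<in>{0..<int M}. \<Sum>y\<in>{0..<int M}. f y * echar M ((x - y) * r))"
    unfolding sum_distrib_right
    by (intro sum.cong refl) (simp add: mult.assoc flip: echar_add, simp add: algebra_simps)
  also have "\<dots> = (\<Sum>y\<in>{0..<int M}. \<Sum>r\<in>{0..<int M}. f y * echar M ((x - y) * r))"
    by (rule sum.swap)
  also have "\<dots> = (\<Sum>y\<in>{0..<int M}. f y * (if int M dvd x - y then of_nat M else 0))"
    by (simp only: sum_echar[OF M] flip: sum_distrib_left)
  \<comment> \<open>By orthogonality only the representative of \<open>x\<close> in the period
    survives.\<close>
  also have "\<dots> = (\<Sum>y\<in>{x mod int M}. f y * (if int M dvd x - y then of_nat M else 0))"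
  proof (rule sum.mono_neutral_right)
    show "\<forall>i\<in>{0..<int M} - {x mod int M}. f i * (if int M dvd x - i then of_nat M else 0) = 0"
      by (auto simp: mod_eq_dvd_iff[symmetric])
  qed (use M in auto)
  also have "\<dots> = of_nat M * f x"
    by (simp add: per mod_eq_dvd_iff[symmetric])
  finally show ?thesis using M by (simp add: field_simps sum_divide_distrib[symmetric])
qed

text \<open>Expand the squared modulus into a triple sum and sum over the frequency first:
  orthogonality leaves only the diagonal \<open>y = z\<close>.\<close>

lemma parseval:
  fixes g :: "int \<Rightarrow> complex"
  assumes M: "M > 0"
  shows "(\<Sum>r\<in>{0..<int M}. (norm (\<Sum>y\<in>{0..<int M}. g y * echar M (- r * y)))\<^sup>2)
       = real M * (\<Sum>y\<in>{0..<int M}. (norm (g y))\<^sup>2)"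
proof -
  let ?Z = "{0..<int M}"
  have "complex_of_real (\<Sum>r\<in>?Z. (norm (\<Sum>y\<in>?Z. g y * echar M (- r * y)))\<^sup>2)
      = (\<Sum>r\<in>?Z. (\<Sum>y\<in>?Z. g y * echar M (- r * y)) * cnj (\<Sum>y\<in>?Z. g y * echar M (- r * y)))"
    by (simp only: of_real_sum complex_norm_square)
  also have "\<dots> = (\<Sum>r\<in>?Z. \<Sum>y\<in>?Z. \<Sum>z\<in>?Z. g y * cnj (g z) * echar M ((z - y) * r))"
    unfolding cnj_sum complex_cnj_mult sum_product
    by (intro sum.cong refl) (simp add: cnj_echar algebra_simps flip: echar_add)
  also have "\<dots> = (\<Sum>y\<in>?Z. \<Sum>z\<in>?Z. \<Sum>r\<in>?Z. g y * cnj (g z) * echar M ((z - y) * r))"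
    by (subst sum.swap, rule sum.cong[OF refl], subst sum.swap, rule refl)
  also have "\<dots> = (\<Sum>y\<in>?Z. \<Sum>z\<in>?Z. g y * cnj (g z) * (if int M dvd z - y then of_nat M else 0))"
    by (simp only: sum_echar[OF M] flip: sum_distrib_left)
  also have "\<dots> = (\<Sum>y\<in>?Z. \<Sum>z\<in>{y}. g y * cnj (g z) * (if int M dvd z - y then of_nat M else 0))"
  proof (rule sum.cong[OF refl], rule sum.mono_neutral_right)
    fix y assume "y \<in> ?Z"
    thus "\<forall>i\<in>?Z - {y}. g y * cnj (g i) * (if int M dvd i - y then of_nat M else 0) = 0"
      using eq_if_dvd_diff by auto
  qed auto
  also have "\<dots> = complex_of_real (real M * (\<Sum>y\<in>?Z. (norm (g y))\<^sup>2))"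
    by (simp add: sum_distrib_left mult.commute flip: complex_norm_square)
  finally show ?thesis by (simp only: of_real_eq_iff)
qed

text \<open>The convolution of \<open>f\<close> with the uniform probability measure on
  \<open>A\<close>.\<close>

definition avg_shift :: "int set \<Rightarrow> (int \<Rightarrow> real) \<Rightarrow> int \<Rightarrow> real" where
  "avg_shift A f x = (\<Sum>a\<in>A. f (x - a)) / card A"

text \<open>The bound on the Fourier coefficients combines Cauchy-Schwarz with Parseval for \<open>f\<close> and for \<open>A\<close>.\<close>

lemma avg_shift_fourier:
  fixes f :: "int \<Rightarrow> real"
  assumes M: "M > 0" and per: "\<And>x. f (x mod int M) = f x"
    and f: "\<And>x. \<bar>f x\<bar> \<le> 1" and A: "A \<subseteq> {0..<int M}" "A \<noteq> {}"
  obtains c where "\<And>x. complex_of_real (avg_shift A f x) = (\<Sum>r\<in>{0..<int M}. c r * echar M (r * x))"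
    and "(\<Sum>r\<in>{0..<int M}. norm (c r)) \<le> sqrt (real M / card A)"
proof -
  let ?Z = "{0..<int M}"
  have fin: "finite A" using A finite_subset by blast
  have cA: "card A > 0" using fin A by (simp add: card_gt_0_iff)
  \<comment> \<open>\<open>fh\<close> and \<open>ah\<close> are the Fourier coefficients of
    \<open>f\<close> and of the uniform measure on \<open>A\<close>; a convolution has their product
    as its coefficients.\<close>
  define fh where "fh r = (\<Sum>y\<in>?Z. complex_of_real (f y) * echar M (- r * y)) / of_nat M" for r
  define ah where "ah r = (\<Sum>a\<in>A. echar M (- r * a)) / of_nat (card A)" for r
  define c where "c r = fh r * ah r" for r
  have inv: "complex_of_real (f x) = (\<Sum>r\<in>?Z. fh r * echar M (r * x))" for x
    unfolding fh_def by (rule fourier_inversion[OF M, of "\<lambda>x. of_real (f x)"]) (simp add: per)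
  have 1: "complex_of_real (avg_shift A f x) = (\<Sum>r\<in>?Z. c r * echar M (r * x))" for x
  proof -
    have "complex_of_real (avg_shift A f x) = (\<Sum>a\<in>A. \<Sum>r\<in>?Z. fh r * echar M (r * (x - a))) / of_nat (card A)"
      by (simp add: avg_shift_def inv)
    also have "(\<Sum>a\<in>A. \<Sum>r\<in>?Z. fh r * echar M (r * (x - a))) = (\<Sum>r\<in>?Z. \<Sum>a\<in>A. fh r * echar M (r * (x - a)))"
      by (rule sum.swap)
    also have "\<dots> = (\<Sum>r\<in>?Z. fh r * (\<Sum>a\<in>A. echar M (- r * a)) * echar M (r * x))"
      unfolding sum_distrib_left sum_distrib_right
      by (intro sum.cong refl) (simp add: algebra_simps mult.assoc flip: echar_add)
    finally have "complex_of_real (avg_shift A f x)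
      = (\<Sum>r\<in>?Z. fh r * (\<Sum>a\<in>A. echar M (- r * a)) * echar M (r * x) / of_nat (card A))"
      by (simp only: sum_divide_distrib)
    thus ?thesis by (simp add: c_def ah_def)
  qed
  have pf: "(\<Sum>r\<in>?Z. (norm (fh r))\<^sup>2) \<le> 1"
  proof -
    have "(\<Sum>r\<in>?Z. (norm (fh r))\<^sup>2) = (\<Sum>r\<in>?Z. (norm (\<Sum>y\<in>?Z. complex_of_real (f y) * echar M (- r * y)))\<^sup>2) / (real M)\<^sup>2"
      by (simp only: fh_def norm_divide power_divide norm_of_nat flip: sum_divide_distrib)
    also have "\<dots> = (\<Sum>y\<in>?Z. (f y)\<^sup>2) / real M"
      unfolding parseval[OF M] using M by (simp add: power2_eq_square)
    also have "(\<Sum>y\<in>?Z. (f y)\<^sup>2) \<le> (\<Sum>y\<in>?Z. 1)"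
      by (intro sum_mono) (metis f abs_square_le_1)
    hence "(\<Sum>y\<in>?Z. (f y)\<^sup>2) / real M \<le> 1" using M by simp
    finally show ?thesis .
  qed
  have pa: "(\<Sum>r\<in>?Z. (norm (ah r))\<^sup>2) = real M / card A"
  proof -
    \<comment> \<open>\<open>parseval\<close> concerns sums over the whole period, so the sum over
      \<open>A\<close> is rewritten with the indicator function of \<open>A\<close>.\<close>
    have ind: "(\<Sum>a\<in>A. echar M (- r * a)) = (\<Sum>y\<in>?Z. (if y \<in> A then 1 else 0) * echar M (- r * y))" for r
    proof -
      have "(\<Sum>y\<in>?Z. (if y \<in> A then 1 else 0) * echar M (- r * y))
          = (\<Sum>y\<in>?Z. if y \<in> A then echar M (- r * y) else 0)"
        by (intro sum.cong) auto
      also have "\<dots> = (\<Sum>y\<in>?Z \<inter> A. echar M (- r * y))" by (rule sum.inter_restrict[symmetric]) simp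
      also have "?Z \<inter> A = A" using A by blast
      finally show ?thesis ..
    qed
    have "(\<Sum>y\<in>?Z. (norm (if y \<in> A then 1 else 0 :: complex))\<^sup>2) = (\<Sum>y\<in>?Z. if y \<in> A then 1 else 0 :: real)"
      by (intro sum.cong) auto
    also have "\<dots> = card (?Z \<inter> A)" by (simp add: sum.If_cases)
    also have "?Z \<inter> A = A" using A by blast
    finally have 2: "(\<Sum>y\<in>?Z. (norm (if y \<in> A then 1 else 0 :: complex))\<^sup>2) = card A" .
    have "(\<Sum>r\<in>?Z. (norm (ah r))\<^sup>2) = (\<Sum>r\<in>?Z. (norm (\<Sum>a\<in>A. echar M (- r * a)))\<^sup>2) / (real (card A))\<^sup>2"
      by (simp only: ah_def norm_divide power_divide norm_of_nat flip: sum_divide_distrib)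
    also have "\<dots> = real M * card A / (real (card A))\<^sup>2"
      unfolding ind parseval[OF M] 2 ..
    finally show ?thesis using cA by (simp add: power2_eq_square)
  qed
  have "(\<Sum>r\<in>?Z. norm (c r)) = (\<Sum>r\<in>?Z. \<bar>norm (fh r)\<bar> * \<bar>norm (ah r)\<bar>)"
    by (simp add: c_def norm_mult)
  also have "\<dots> \<le> L2_set (\<lambda>r. norm (fh r)) ?Z * L2_set (\<lambda>r. norm (ah r)) ?Z"
    by (rule L2_set_mult_ineq)
  also have "\<dots> \<le> 1 * sqrt (real M / card A)"
    unfolding L2_set_def pa using pf by (intro mult_right_mono) auto
  finally have "(\<Sum>r\<in>?Z. norm (c r)) \<le> sqrt (real M / card A)" by simp
  with 1 that show ?thesis by blast
qed

text \<open>Convolution with the law of \<open>s - t\<close> for independent uniform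
  \<open>s\<close>, \<open>t\<close> in \<open>T\<close>. Shifts by differences make the Fourier
  multiplier a squared modulus, real and in [0,1], so that iteration damps every frequency where it
  is small.\<close>

definition diff_avg :: "int set \<Rightarrow> (int \<Rightarrow> real) \<Rightarrow> int \<Rightarrow> real" where
  "diff_avg T f x = (\<Sum>s\<in>T. \<Sum>t\<in>T. f (x + (s - t))) / (real (card T))\<^sup>2"

text \<open>The squared modulus of the Fourier transform of the uniform measure on \<open>T\<close>,
  which is the multiplier of \<open>diff_avg T\<close> at \<open>r\<close>. The large spectrum of
  \<open>T\<close> is where it is at least 1/4.\<close>

definition spec_weight :: "nat \<Rightarrow> int set \<Rightarrow> int \<Rightarrow> real" where
  "spec_weight M T r = (norm (\<Sum>t\<in>T. echar M (r * t)) / card T)\<^sup>2"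

lemma spec_weight_nonneg: "0 \<le> spec_weight M T r"
  by (simp add: spec_weight_def)

lemma spec_weight_le_1: "spec_weight M T r \<le> 1"
proof -
  have "norm (\<Sum>t\<in>T. echar M (r * t)) \<le> (\<Sum>t\<in>T. norm (echar M (r * t)))" by (rule norm_sum)
  hence "norm (\<Sum>t\<in>T. echar M (r * t)) / card T \<le> 1"
    by (cases "card T = 0") (auto simp: divide_le_eq)
  thus ?thesis unfolding spec_weight_def by (intro power_le_one) auto
qed

text \<open>The double sum of \<open>echar M (r * (s - t))\<close> factors into an exponential sum
  over \<open>T\<close> times its conjugate. If \<open>card T = 0\<close>, both sides vanish by
  division by zero.\<close>

lemma diff_avg_fourier:
  assumes "\<And>x. complex_of_real (f x) = (\<Sum>r\<in>Z. c r * echar M (r * x))"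
  shows "complex_of_real (diff_avg T f x) = (\<Sum>r\<in>Z. (c r * of_real (spec_weight M T r)) * echar M (r * x))"
proof -
  have sw: "(\<Sum>s\<in>T. \<Sum>t\<in>T. echar M (r * (s - t))) = of_real (spec_weight M T r) * (of_nat (card T))\<^sup>2" for r
  proof (cases "card T = 0")
    case False
    have "(\<Sum>s\<in>T. \<Sum>t\<in>T. echar M (r * (s - t))) = (\<Sum>s\<in>T. echar M (r * s)) * cnj (\<Sum>t\<in>T. echar M (r * t))"
      unfolding cnj_sum sum_product by (intro sum.cong refl) (simp add: cnj_echar algebra_simps flip: echar_add)
    also have "\<dots> = of_real ((norm (\<Sum>t\<in>T. echar M (r * t)))\<^sup>2)" by (simp only: complex_norm_square)
    finally show ?thesis using False by (simp add: spec_weight_def power_divide)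
  next
    case True
    thus ?thesis by (cases "finite T") auto
  qed
  have "(\<Sum>s\<in>T. \<Sum>t\<in>T. complex_of_real (f (x + (s - t))))
      = (\<Sum>s\<in>T. \<Sum>t\<in>T. \<Sum>r\<in>Z. c r * echar M (r * x) * echar M (r * (s - t)))"
    unfolding assms by (intro sum.cong refl) (simp add: distrib_left echar_add mult.assoc)
  also have "\<dots> = (\<Sum>s\<in>T. \<Sum>r\<in>Z. \<Sum>t\<in>T. c r * echar M (r * x) * echar M (r * (s - t)))"
    by (intro sum.cong refl sum.swap)
  also have "\<dots> = (\<Sum>r\<in>Z. \<Sum>s\<in>T. \<Sum>t\<in>T. c r * echar M (r * x) * echar M (r * (s - t)))"
    by (rule sum.swap)
  also have "\<dots> = (\<Sum>r\<in>Z. c r * echar M (r * x) * (of_real (spec_weight M T r) * (of_nat (card T))\<^sup>2))"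
    by (simp only: sw flip: sum_distrib_left)
  also have "\<dots> = (\<Sum>r\<in>Z. (c r * of_real (spec_weight M T r)) * echar M (r * x)) * (of_nat (card T))\<^sup>2"
    unfolding sum_distrib_right by (intro sum.cong refl) (simp add: mult_ac)
  finally have eq: "(\<Sum>s\<in>T. \<Sum>t\<in>T. complex_of_real (f (x + (s - t)))) = \<dots>" .
  show ?thesis
  proof (cases "card T = 0")
    case False
    thus ?thesis by (simp add: diff_avg_def eq)
  next
    case True
    thus ?thesis by (simp add: diff_avg_def spec_weight_def)
  qed
qed

lemma diff_avg_funpow_fourier:
  assumes "\<And>x. complex_of_real (f x) = (\<Sum>r\<in>Z. c r * echar M (r * x))"
  shows "complex_of_real ((diff_avg T ^^ l) f x)
       = (\<Sum>r\<in>Z. (c r * of_real (spec_weight M T r ^ l)) * echar M (r * x))"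
proof (induction l arbitrary: x)
  case 0
  show ?case using assms by simp
next
  case (Suc l)
  from diff_avg_fourier[OF this]
  show ?case by (simp add: mult_ac)
qed

section \<open>Croot-Sisask almost periodicity\<close>

lemma exp_le_quadratic:
  fixes x :: real
  assumes "\<bar>x\<bar> \<le> 1"
  shows "exp x \<le> 1 + x + x\<^sup>2"
proof (cases "x \<ge> 0")
  case True
  thus ?thesis using assms exp_bound by auto
next
  case False
  have "x * x\<^sup>2 \<le> 0" using False by (intro mult_nonpos_nonneg) auto
  hence "1 \<le> (1 + x + x\<^sup>2) * (1 - x)"
    by (simp add: algebra_simps power2_eq_square)
  also have "\<dots> \<le> (1 + x + x\<^sup>2) * exp (- x)"
  proof (rule mult_left_mono)
    show "1 - x \<le> exp (- x)" using exp_ge_add_one_self[of "- x"] by simp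
    show "0 \<le> 1 + x + x\<^sup>2" using assms zero_le_power2[of x] by linarith
  qed
  finally show ?thesis by (simp add: exp_minus field_simps)
qed

text \<open>Chernoff's method with tuples counted instead of probabilities. The exponential moment
  over all tuples factors into a power of the moment over \<open>A\<close>, where the zero mean
  cancels the linear term of \<open>exp_le_quadratic\<close>.\<close>

lemma hoeffding_count:
  fixes u :: "'a \<Rightarrow> real" and e :: real
  assumes fin: "finite A" and u: "\<And>a. a \<in> A \<Longrightarrow> \<bar>u a\<bar> \<le> 1" and mean: "sum u A = 0"
    and e: "0 \<le> e" "e \<le> 2"
  shows "real (card {g \<in> {..<n} \<rightarrow>\<^sub>E A. real n * e < (\<Sum>i<n. u (g i))}) \<le> real (card A) ^ n * exp (- (e\<^sup>2 * n / 4))"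
proof -
  let ?P = "{..<n} \<rightarrow>\<^sub>E A"
  let ?B = "{g \<in> ?P. real n * e < (\<Sum>i<n. u (g i))}"
  \<comment> \<open>This choice minimises h^2 - h e, the exponent per coordinate;
    \<open>e \<le> 2\<close> keeps \<open>h * u a\<close> in the range of
    \<open>exp_le_quadratic\<close>.\<close>
  define h where "h = e / 2"
  have h: "0 \<le> h" "h \<le> 1" using e by (auto simp: h_def)
  have finP: "finite ?P" using fin by (intro finite_PiE) auto
  have "(\<Sum>a\<in>A. exp (h * u a)) \<le> (\<Sum>a\<in>A. 1 + h * u a + h\<^sup>2)"
  proof (rule sum_mono)
    fix a assume a: "a \<in> A"
    have "\<bar>h * u a\<bar> \<le> 1" using u[OF a] h by (simp add: abs_mult mult_le_one)
    hence "exp (h * u a) \<le> 1 + h * u a + (h * u a)\<^sup>2" by (rule exp_le_quadratic)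
    moreover have "(u a)\<^sup>2 \<le> 1" using u[OF a] by (simp add: abs_square_le_1)
    hence "(h * u a)\<^sup>2 \<le> h\<^sup>2" by (simp add: power_mult_distrib mult_left_le)
    ultimately show "exp (h * u a) \<le> 1 + h * u a + h\<^sup>2" by linarith
  qed
  also have "\<dots> = card A * (1 + h\<^sup>2)"
    using mean by (simp add: sum.distrib algebra_simps flip: sum_distrib_left)
  also have "\<dots> \<le> card A * exp (h\<^sup>2)" by (intro mult_left_mono) auto
  finally have one: "(\<Sum>a\<in>A. exp (h * u a)) \<le> card A * exp (h\<^sup>2)" .
  have "real (card ?B) = (\<Sum>g\<in>?B. 1)" by simp
  also have "\<dots> \<le> (\<Sum>g\<in>?B. exp (h * (\<Sum>i<n. u (g i)) - h * (n * e)))"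
    using h by (intro sum_mono) (auto simp: right_diff_distrib[symmetric] intro!: mult_nonneg_nonneg)
  also have "\<dots> \<le> (\<Sum>g\<in>?P. exp (h * (\<Sum>i<n. u (g i)) - h * (n * e)))"
    by (intro sum_mono2 finP) auto
  also have "\<dots> = exp (- h * (n * e)) * (\<Sum>g\<in>?P. \<Prod>i<n. exp (h * u (g i)))"
    unfolding sum_distrib_left
    by (intro sum.cong refl) (simp add: exp_diff exp_minus exp_sum sum_distrib_left field_simps)
  also have "(\<Sum>g\<in>?P. \<Prod>i<n. exp (h * u (g i))) = (\<Sum>a\<in>A. exp (h * u a)) ^ n"
    using prod_sum_PiE[of "{..<n}" "\<lambda>_. A" "\<lambda>_ a. exp (h * u a)"] fin by simp
  also have "exp (- h * (n * e)) * \<dots> \<le> exp (- h * (n * e)) * (card A * exp (h\<^sup>2)) ^ n"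
    by (intro mult_left_mono power_mono one sum_nonneg) auto
  also have "\<dots> = real (card A) ^ n * (exp (- h * (n * e)) * exp (h\<^sup>2) ^ n)"
    by (simp add: power_mult_distrib)
  also have "exp (- h * (n * e)) * exp (h\<^sup>2) ^ n = exp (- (e\<^sup>2 * n / 4))"
    by (simp add: h_def power2_eq_square flip: exp_of_nat_mult exp_add)
  finally show ?thesis .
qed

lemma hoeffding_count_abs:
  fixes u :: "'a \<Rightarrow> real" and e :: real
  assumes fin: "finite A" and u: "\<And>a. a \<in> A \<Longrightarrow> \<bar>u a\<bar> \<le> 1" and mean: "sum u A = 0"
    and e: "0 \<le> e" "e \<le> 2"
  shows "real (card {g \<in> {..<n} \<rightarrow>\<^sub>E A. real n * e < \<bar>\<Sum>i<n. u (g i)\<bar>}) \<le> 2 * real (card A) ^ n * exp (- (e\<^sup>2 * n / 4))"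
proof -
  let ?P = "{..<n} \<rightarrow>\<^sub>E A"
  have finP: "finite ?P" using fin by (intro finite_PiE) auto
  have "{g \<in> ?P. real n * e < \<bar>\<Sum>i<n. u (g i)\<bar>}
     \<subseteq> {g \<in> ?P. real n * e < (\<Sum>i<n. u (g i))} \<union> {g \<in> ?P. real n * e < (\<Sum>i<n. - u (g i))}"
    by (auto simp: sum_negf abs_if split: if_splits)
  hence "card {g \<in> ?P. real n * e < \<bar>\<Sum>i<n. u (g i)\<bar>}
     \<le> card ({g \<in> ?P. real n * e < (\<Sum>i<n. u (g i))} \<union> {g \<in> ?P. real n * e < (\<Sum>i<n. - u (g i))})"
    using finP by (intro card_mono) auto
  also have "\<dots> \<le> card {g \<in> ?P. real n * e < (\<Sum>i<n. u (g i))} + card {g \<in> ?P. real n * e < (\<Sum>i<n. - u (g i))}"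
    by (rule card_Un_le)
  finally have "real (card {g \<in> ?P. real n * e < \<bar>\<Sum>i<n. u (g i)\<bar>})
     \<le> real (card {g \<in> ?P. real n * e < (\<Sum>i<n. u (g i))}) + real (card {g \<in> ?P. real n * e < (\<Sum>i<n. - u (g i))})"
    by linarith
  moreover have "real (card {g \<in> ?P. real n * e < (\<Sum>i<n. u (g i))}) \<le> real (card A) ^ n * exp (- (e\<^sup>2 * n / 4))"
    using assms by (intro hoeffding_count) auto
  moreover have "real (card {g \<in> ?P. real n * e < (\<Sum>i<n. - u (g i))}) \<le> real (card A) ^ n * exp (- (e\<^sup>2 * n / 4))"
    using assms by (intro hoeffding_count) (auto simp: sum_negf)
  ultimately show ?thesis by linarith
qed

section \<open>Double counting, and counting over a full period\<close>

lemma sum_card_swap: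
  assumes "finite X" "finite Y"
  shows "(\<Sum>x\<in>X. card {y \<in> Y. R x y}) = (\<Sum>y\<in>Y. card {x \<in> X. R x y})"
proof -
  have "(\<Sum>x\<in>X. card {y \<in> Y. R x y}) = (\<Sum>x\<in>X. \<Sum>y\<in>Y. if R x y then 1 else 0)"
    using assms by (intro sum.cong refl) (simp add: sum.If_cases Int_def)
  also have "\<dots> = (\<Sum>y\<in>Y. \<Sum>x\<in>X. if R x y then 1 else 0)" by (rule sum.swap)
  also have "\<dots> = (\<Sum>y\<in>Y. card {x \<in> X. R x y})"
    using assms by (intro sum.cong refl) (simp add: sum.If_cases Int_def)
  finally show ?thesis .
qed

lemma card_markov:
  fixes w :: "'a \<Rightarrow> real" and a :: real
  assumes "finite X" "\<And>x. x \<in> X \<Longrightarrow> 0 \<le> w x" "0 \<le> a"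
  shows "real (card {x \<in> X. a < w x}) * a \<le> sum w X"
proof -
  have "real (card {x \<in> X. a < w x}) * a = (\<Sum>x\<in>{x \<in> X. a < w x}. a)" by simp
  also have "\<dots> \<le> (\<Sum>x\<in>{x \<in> X. a < w x}. w x)" by (intro sum_mono) auto
  also have "\<dots> \<le> sum w X" using assms by (intro sum_mono2) auto
  finally show ?thesis .
qed

lemma card_shift_periodic:
  assumes per: "\<And>x. P (x mod int M) = P x"
  shows "card {x \<in> {0..<int M}. P (x + t)} = card {x \<in> {0..<int M}. P x}"
proof -
  have "card {x \<in> {0..<int M}. P (x + t)} = (\<Sum>x\<in>{0..<int M}. if P (x + t) then 1 else 0)"
    by (simp add: sum.If_cases Int_def)
  also have "\<dots> = (\<Sum>x\<in>{0..<int M}. if P x then 1 else 0)"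
    by (rule sum_shift_periodic[of "\<lambda>x. if P x then 1 else 0"]) (simp add: per)
  also have "\<dots> = card {x \<in> {0..<int M}. P x}"
    by (simp add: sum.If_cases Int_def)
  finally show ?thesis .
qed

lemma avg_shift_periodic:
  assumes per: "\<And>x. f (x mod int M) = f x"
  shows "avg_shift A f (x mod int M) = avg_shift A f x"
proof -
  have "f (x mod int M - a) = f (x - a)" for a
    by (metis per mod_diff_left_eq)
  thus ?thesis by (simp add: avg_shift_def)
qed

lemma avg_shift_bounds:
  assumes f: "\<And>x. 0 \<le> f x" "\<And>x. f x \<le> 1"
  shows "0 \<le> avg_shift A f x" "avg_shift A f x \<le> 1"
proof -
  show "0 \<le> avg_shift A f x" using f by (simp add: avg_shift_def sum_nonneg)
  have "(\<Sum>a\<in>A. f (x - a)) \<le> (\<Sum>a\<in>A. 1)" by (intro sum_mono f)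
  thus "avg_shift A f x \<le> 1" unfolding avg_shift_def by (cases "card A = 0") (auto simp: divide_le_eq)
qed

text \<open>Most \<open>n\<close>-tuples from \<open>A\<close> approximate the convolution by their empirical average. By pigeonhole
  many translates of good tuples coincide, and the corresponding shifts are almost-periods.\<close>

lemma croot_sisask:
  fixes f :: "int \<Rightarrow> real" and e \<eta> :: real
  assumes M: "M > 0" and per: "\<And>x. f (x mod int M) = f x"
    and f: "\<And>x. 0 \<le> f x" "\<And>x. f x \<le> 1" and A: "A \<subseteq> {0..<int M}" "A \<noteq> {}"
    and e: "0 < e" "e \<le> 2" and n: "n > 0" and \<eta>: "4 * exp (- (e\<^sup>2 * n / 4)) \<le> \<eta>"
  obtains T where "T \<subseteq> {0..<int M}" "(real (card A) / (2 * M)) ^ n * M / 2 \<le> card T"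
    "\<And>s t. s \<in> T \<Longrightarrow> t \<in> T \<Longrightarrow>
      card {x \<in> {0..<int M}. 2 * e < \<bar>avg_shift A f (x + (s - t)) - avg_shift A f x\<bar>} \<le> 2 * \<eta> * M"
proof -
  let ?Z = "{0..<int M}"
  let ?P = "{..<n} \<rightarrow>\<^sub>E A"
  have fin: "finite A" using A finite_subset by blast
  have cA: "card A > 0" using fin A by (simp add: card_gt_0_iff)
  have finP: "finite ?P" using fin by (intro finite_PiE) auto
  have cP: "card ?P = card A ^ n" by (simp add: card_PiE)
  have \<eta>0: "\<eta> > 0" by (rule less_le_trans[OF _ \<eta>]) simp
  define F where "F = avg_shift A f"
  \<comment> \<open>The empirical version of \<open>F\<close>: the average over a sampled tuple in
    place of the average over \<open>A\<close>.\<close>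
  define S where "S g x = (\<Sum>i<n. f (x - g i)) / n" for g :: "nat \<Rightarrow> int" and x
  define bad where "bad g x \<longleftrightarrow> e < \<bar>S g x - F x\<bar>" for g x
  have Fper: "F (x mod int M) = F x" for x unfolding F_def by (rule avg_shift_periodic) (rule per)
  have Sper: "S g (x mod int M) = S g x" for g x
  proof -
    have "f (x mod int M - a) = f (x - a)" for a by (metis per mod_diff_left_eq)
    thus ?thesis by (simp add: S_def)
  qed
  have badper: "bad g (x mod int M) = bad g x" for g x by (simp add: bad_def Fper Sper)
  have tail: "real (card {g \<in> ?P. bad g x}) \<le> 2 * real (card A) ^ n * exp (- (e\<^sup>2 * n / 4))" for x
  proof -
    define u where "u a = f (x - a) - F x" for a
    have "bad g x \<longleftrightarrow> real n * e < \<bar>\<Sum>i<n. u (g i)\<bar>" for g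
    proof -
      have "(\<Sum>i<n. u (g i)) = n * (S g x - F x)"
        using n by (simp add: u_def S_def sum_subtractf right_diff_distrib)
      thus ?thesis using n by (simp add: bad_def abs_mult)
    qed
    moreover have "sum u A = 0"
      using cA by (simp add: u_def F_def avg_shift_def sum_subtractf)
    moreover have "\<bar>u a\<bar> \<le> 1" for a
      unfolding u_def F_def using f[of "x - a"] avg_shift_bounds[of f A x, OF f] by linarith
    ultimately show ?thesis using hoeffding_count_abs[of A u e n] fin e by simp
  qed
  define G where "G = {g \<in> ?P. card {x \<in> ?Z. bad g x} \<le> \<eta> * M}"
  have GP: "G \<subseteq> ?P" by (auto simp: G_def)
  hence finG: "finite G" using finP finite_subset by blast
  \<comment> \<open>At every point the proportion of bad tuples is at most \<eta>/2, thanks to the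
    factor 4 in the hypothesis on \<eta>. Averaging over points and Markov's inequality leave at
    least half of the tuples good.\<close>
  have cG: "real (card A) ^ n / 2 \<le> card G"
  proof -
    have "real (card {g \<in> ?P. \<eta> * M < card {x \<in> ?Z. bad g x}}) * (\<eta> * M) \<le> (\<Sum>g\<in>?P. real (card {x \<in> ?Z. bad g x}))"
      using \<eta>0 by (intro card_markov finP) auto
    also have "\<dots> = (\<Sum>x\<in>?Z. real (card {g \<in> ?P. bad g x}))"
      unfolding of_nat_sum[symmetric] using sum_card_swap[OF finP, of ?Z bad] by simp
    also have "\<dots> \<le> (\<Sum>x\<in>?Z. 2 * real (card A) ^ n * exp (- (e\<^sup>2 * n / 4)))"
      by (intro sum_mono tail)
    also have "\<dots> = M * (real (card A) ^ n / 2 * (4 * exp (- (e\<^sup>2 * n / 4))))" by simp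
    also have "\<dots> \<le> M * (real (card A) ^ n / 2 * \<eta>)" by (intro mult_left_mono \<eta>) auto
    finally have "real (card {g \<in> ?P. \<eta> * M < card {x \<in> ?Z. bad g x}}) * (\<eta> * M) \<le> real (card A) ^ n / 2 * (\<eta> * M)"
      by (simp only: mult_ac)
    hence few: "real (card {g \<in> ?P. \<eta> * M < card {x \<in> ?Z. bad g x}}) \<le> real (card A) ^ n / 2"
      by (rule mult_right_le_imp_le) (simp add: M \<eta>0)
    have "?P - G = {g \<in> ?P. \<eta> * M < card {x \<in> ?Z. bad g x}}"
      unfolding G_def not_le[symmetric] by blast
    moreover have "card (?P - G) = card ?P - card G" using GP finG by (simp add: card_Diff_subset)
    moreover have "card G \<le> card ?P" using GP finP card_mono by blast
    ultimately have split: "card ?P = card G + card {g \<in> ?P. \<eta> * M < card {x \<in> ?Z. bad g x}}"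
      by (metis le_add_diff_inverse)
    have "real (card ?P) = real (card G) + real (card {g \<in> ?P. \<eta> * M < card {x \<in> ?Z. bad g x}})"
      by (simp only: split of_nat_add)
    moreover have "real (card ?P) = real (card A) ^ n" by (simp only: cP of_nat_power)
    ultimately show ?thesis using few by linarith
  qed
  define \<phi> where "\<phi> = (\<lambda>(g, s). \<lambda>i\<in>{..<n}. g i + (s::int))"
  \<comment> \<open>The translated tuples are not reduced mod \<open>M\<close>; their entries lie in
    an interval of length \<open>2 * M\<close>, which produces the 2 in the lower bound for
    \<open>card T\<close>.\<close>
  define V where "V = {..<n} \<rightarrow>\<^sub>E {0..<int (2 * M)}"
  have "\<phi> \<in> G \<times> ?Z \<rightarrow> V"
  proof
    fix p assume p: "p \<in> G \<times> ?Z"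
    obtain g s where gs: "p = (g, s)" by force
    have "g \<in> ?P" using p gs GP by blast
    hence "g i \<in> ?Z" if "i < n" for i
      using A(1) that PiE_mem[of g "{..<n}" "\<lambda>_. A" i] by blast
    moreover have "0 \<le> s" "s < int M" using p gs by auto
    ultimately have "0 \<le> g i + s \<and> g i + s < 2 * int M" if "i < n" for i
      using that by fastforce
    thus "\<phi> p \<in> V" by (auto simp: gs \<phi>_def V_def)
  qed
  moreover have "finite V" by (auto simp: V_def intro!: finite_PiE)
  moreover have "V \<noteq> {}" using M by (auto simp: V_def PiE_eq_empty_iff)
  ultimately obtain v where v: "card (G \<times> ?Z) \<le> card (\<phi> -` {v} \<inter> (G \<times> ?Z)) * card V"
    using pigeonhole_card[of \<phi> "G \<times> ?Z" V] finG by auto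
  \<comment> \<open>\<open>T\<close> collects the translations in one fibre of \<phi> of at least
    average size. The tuple is recovered from \<open>v\<close> and \<open>s\<close>, so
    \<open>T\<close> is as large as the fibre.\<close>
  define T where "T = snd ` (\<phi> -` {v} \<inter> (G \<times> ?Z))"
  have inj: "inj_on snd (\<phi> -` {v} \<inter> (G \<times> ?Z))"
  proof (rule inj_onI)
    fix p q assume p: "p \<in> \<phi> -` {v} \<inter> (G \<times> ?Z)" and q: "q \<in> \<phi> -` {v} \<inter> (G \<times> ?Z)" and eq: "snd p = snd q"
    obtain g h s where gh: "p = (g, s)" "q = (h, s)" using eq by (metis prod.collapse)
    have "g = h"
    proof
      fix i
      have "\<phi> (g, s) i = \<phi> (h, s) i" using p q gh by simp
      moreover have "g \<in> ?P" "h \<in> ?P" using p q gh GP by auto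
      ultimately show "g i = h i"
        by (cases "i < n") (auto simp: \<phi>_def PiE_def extensional_def)
    qed
    thus "p = q" using gh by simp
  qed
  have TZ: "T \<subseteq> ?Z" by (auto simp: T_def)
  have cV: "card V = (2 * M) ^ n" by (simp add: V_def card_PiE nat_mult_distrib power_mult_distrib)
  have "card G * M \<le> card T * (2 * M) ^ n"
    using v by (simp add: T_def card_image[OF inj] cV card_cartesian_product)
  hence "real (card G * M) \<le> real (card T * (2 * M) ^ n)" by (simp only: of_nat_le_iff)
  moreover have "real (card A) ^ n / 2 * M \<le> real (card G * M)"
    unfolding of_nat_mult by (rule mult_right_mono[OF cG]) simp
  ultimately have "real (card A) ^ n / 2 * M \<le> card T * (2 * real M) ^ n" by simp
  moreover have "0 < (2 * real M) ^ n" using M by simp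
  ultimately have "real (card A) ^ n / 2 * M / (2 * real M) ^ n \<le> card T"
    by (simp only: pos_divide_le_eq)
  hence cT: "(real (card A) / (2 * M)) ^ n * M / 2 \<le> card T"
    by (simp add: power_divide)
  \<comment> \<open>Subtracting \<open>s\<close> from \<open>v\<close> gives a good tuple, so the
    one function \<open>S v\<close>, shifted by any \<open>s\<close> in \<open>T\<close>,
    approximates \<open>F\<close>.\<close>
  have Tv: "card {x \<in> ?Z. e < \<bar>S v (x + s) - F x\<bar>} \<le> \<eta> * M" if "s \<in> T" for s
  proof -
    from that[unfolded T_def] obtain p where p: "s = snd p" "p \<in> \<phi> -` {v} \<inter> (G \<times> ?Z)"
      by (rule imageE)
    define g where "g = fst p"
    have g: "g \<in> G" "\<phi> (g, s) = v" using p by (auto simp: g_def mem_Times_iff)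
    have "v i = g i + s" if "i < n" for i using that unfolding g(2)[symmetric] \<phi>_def by simp
    hence "S v (x + s) = S g x" for x by (simp add: S_def)
    thus ?thesis using g(1) by (simp add: G_def bad_def)
  qed
  have finZ: "finite {x \<in> ?Z. R x}" for R by (rule finite_subset[of _ ?Z]) auto
  have "card {x \<in> ?Z. 2 * e < \<bar>F (x + (s - t)) - F x\<bar>} \<le> 2 * \<eta> * M" if st: "s \<in> T" "t \<in> T" for s t
  proof -
    define Q where "Q t x \<longleftrightarrow> e < \<bar>S v (x + t) - F x\<bar>" for t x
    have "Q t (x mod int M) = Q t x" for x
    proof -
      have "S v (x mod int M + t) = S v (x + t)" by (metis Sper mod_add_left_eq)
      thus ?thesis by (simp add: Q_def Fper)
    qed
    hence 1: "card {x \<in> ?Z. Q t (x + (s - t))} = card {x \<in> ?Z. Q t x}"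
      by (rule card_shift_periodic)
    \<comment> \<open>\<open>S v (x + s)\<close> is also \<open>S v ((x + (s - t)) + t)\<close>, so
      it approximates both \<open>F x\<close> and \<open>F (x + (s - t))\<close>; the triangle
      inequality compares the two.\<close>
    have "{x \<in> ?Z. 2 * e < \<bar>F (x + (s - t)) - F x\<bar>} \<subseteq> {x \<in> ?Z. Q s x} \<union> {x \<in> ?Z. Q t (x + (s - t))}"
      by (auto simp: Q_def)
    hence "card {x \<in> ?Z. 2 * e < \<bar>F (x + (s - t)) - F x\<bar>} \<le> card ({x \<in> ?Z. Q s x} \<union> {x \<in> ?Z. Q t (x + (s - t))})"
      by (rule card_mono[rotated]) (intro finite_UnI finZ)
    also have "\<dots> \<le> card {x \<in> ?Z. Q s x} + card {x \<in> ?Z. Q t (x + (s - t))}" by (rule card_Un_le)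
    finally show ?thesis using Tv[OF st(1)] Tv[OF st(2)] 1 by (simp add: Q_def)
  qed
  with TZ cT that show ?thesis by (simp add: F_def)
qed

section \<open>Chang's theorem\<close>

definition dissociated :: "nat \<Rightarrow> int set \<Rightarrow> bool" where
  "dissociated M L \<longleftrightarrow> (\<forall>\<epsilon>. (\<forall>j\<in>L. \<epsilon> j \<in> {-1, 0, 1}) \<longrightarrow> int M dvd (\<Sum>j\<in>L. \<epsilon> j * j) \<longrightarrow> (\<forall>j\<in>L. \<epsilon> j = 0))"

text \<open>Split each real part into a character and its conjugate and multiply out. Each term is a
  character whose frequency is a combination of \<open>L\<close> with coefficients -1, 0, 1;
  dissociativity makes all but the constant term sum to zero.\<close>

lemma riesz_product_sum:
  assumes M: "M > 0" and fin: "finite L" and dis: "dissociated M L"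
  shows "(\<Sum>x\<in>{0..<int M}. \<Prod>j\<in>L. 1 + h * Re (c j * echar M (j * x))) = real M"
proof -
  let ?Z = "{0..<int M}"
  let ?E = "{-1, 0, 1 :: int}"
  define \<kappa> where "\<kappa> j \<epsilon> = (if \<epsilon> = 0 then 1 else if \<epsilon> = 1 then of_real h * c j / 2 else of_real h * cnj (c j) / 2)" for j \<epsilon> :: int
  have factor: "complex_of_real (1 + h * Re (c j * echar M (j * x))) = (\<Sum>\<epsilon>\<in>?E. \<kappa> j \<epsilon> * echar M (\<epsilon> * j * x))" for j x
  proof -
    let ?z = "c j * echar M (j * x)"
    have "cnj ?z = cnj (c j) * echar M (- (j * x))" by (simp add: cnj_echar)
    moreover have "complex_of_real (Re ?z) = (?z + cnj ?z) / 2" by (simp add: complex_eq_iff)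
    ultimately show ?thesis by (simp add: \<kappa>_def algebra_simps add_divide_distrib)
  qed
  have "complex_of_real (\<Sum>x\<in>?Z. \<Prod>j\<in>L. 1 + h * Re (c j * echar M (j * x)))
      = (\<Sum>x\<in>?Z. \<Prod>j\<in>L. \<Sum>\<epsilon>\<in>?E. \<kappa> j \<epsilon> * echar M (\<epsilon> * j * x))"
    by (simp only: of_real_sum of_real_prod factor)
  also have "\<dots> = (\<Sum>x\<in>?Z. \<Sum>g\<in>L \<rightarrow>\<^sub>E ?E. \<Prod>j\<in>L. \<kappa> j (g j) * echar M (g j * j * x))"
    by (intro sum.cong refl prod_sum_PiE fin) auto
  also have "\<dots> = (\<Sum>x\<in>?Z. \<Sum>g\<in>L \<rightarrow>\<^sub>E ?E. (\<Prod>j\<in>L. \<kappa> j (g j)) * echar M ((\<Sum>j\<in>L. g j * j) * x))"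
    by (simp add: prod.distrib sum_distrib_right echar_sum[OF fin])
  also have "\<dots> = (\<Sum>g\<in>L \<rightarrow>\<^sub>E ?E. \<Sum>x\<in>?Z. (\<Prod>j\<in>L. \<kappa> j (g j)) * echar M ((\<Sum>j\<in>L. g j * j) * x))"
    by (rule sum.swap)
  also have "\<dots> = (\<Sum>g\<in>L \<rightarrow>\<^sub>E ?E. (\<Prod>j\<in>L. \<kappa> j (g j)) * (if int M dvd (\<Sum>j\<in>L. g j * j) then of_nat M else 0))"
    by (simp only: sum_echar[OF M] flip: sum_distrib_left)
  also have "\<dots> = (\<Sum>g\<in>{\<lambda>j\<in>L. 0}. (\<Prod>j\<in>L. \<kappa> j (g j)) * (if int M dvd (\<Sum>j\<in>L. g j * j) then of_nat M else 0))"
  proof (rule sum.mono_neutral_right)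
    show "finite (L \<rightarrow>\<^sub>E ?E)" by (intro finite_PiE fin) auto
    show "{\<lambda>j\<in>L. 0} \<subseteq> L \<rightarrow>\<^sub>E ?E" by auto
    show "\<forall>g\<in>(L \<rightarrow>\<^sub>E ?E) - {\<lambda>j\<in>L. 0}. (\<Prod>j\<in>L. \<kappa> j (g j)) * (if int M dvd (\<Sum>j\<in>L. g j * j) then of_nat M else 0) = 0"
    proof
      fix g assume g: "g \<in> (L \<rightarrow>\<^sub>E ?E) - {\<lambda>j\<in>L. 0}"
      have "\<not> int M dvd (\<Sum>j\<in>L. g j * j)"
      proof
        assume "int M dvd (\<Sum>j\<in>L. g j * j)"
        moreover have "\<forall>j\<in>L. g j \<in> ?E" using g by (auto simp only: PiE_mem Diff_iff)
        ultimately have "\<forall>j\<in>L. g j = 0" using dis unfolding dissociated_def by blast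
        hence "g = (\<lambda>j\<in>L. 0)" using g by (auto simp: PiE_def extensional_def restrict_def)
        thus False using g by simp
      qed
      thus "(\<Prod>j\<in>L. \<kappa> j (g j)) * (if int M dvd (\<Sum>j\<in>L. g j * j) then of_nat M else 0) = 0" by simp
    qed
  qed
  also have "\<dots> = complex_of_real (real M)" by (simp add: \<kappa>_def)
  finally show ?thesis by (simp only: of_real_eq_iff)
qed

text \<open>Jensen's inequality for the exponential, from its tangent line at the mean.\<close>

lemma exp_mean_le:
  fixes g :: "'a \<Rightarrow> real"
  assumes "finite T" "T \<noteq> {}"
  shows "card T * exp (sum g T / card T) \<le> (\<Sum>t\<in>T. exp (g t))"
proof -
  define m where "m = sum g T / card T"
  have c: "card T > 0" using assms by (simp add: card_gt_0_iff)
  have "card T * exp m = (\<Sum>t\<in>T. exp m * (1 + (g t - m)))"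
    using c by (simp add: m_def sum.distrib sum_subtractf flip: sum_distrib_left)
  also have "\<dots> \<le> (\<Sum>t\<in>T. exp m * exp (g t - m))"
    by (intro sum_mono mult_left_mono exp_ge_add_one_self) auto
  also have "\<dots> = (\<Sum>t\<in>T. exp (g t))" by (simp flip: exp_add)
  finally show ?thesis by (simp add: m_def)
qed

text \<open>Jensen's inequality on \<open>T\<close> bounds the mean of a Riesz product over \<open>T\<close> from below, while
  dissociativity makes its mean over the whole group equal to one.\<close>

lemma dissociated_spectrum_card:
  assumes M: "M > 0" and T: "T \<subseteq> {0..<int M}" "T \<noteq> {}" and fin: "finite L" and dis: "dissociated M L"
    and spec: "\<And>j. j \<in> L \<Longrightarrow> 1 / 4 \<le> spec_weight M T j"
  shows "card L / 32 \<le> ln (M / card T)"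
proof -
  let ?Z = "{0..<int M}"
  have finT: "finite T" using T finite_subset by blast
  have c: "card T > 0" using finT T by (simp add: card_gt_0_iff)
  define S where "S j = (\<Sum>t\<in>T. echar M (j * t))" for j
  \<comment> \<open>The phase that rotates the exponential sum \<open>S j\<close> onto the
    nonnegative real axis, so that \<open>u j\<close> has mean at least 1/2 over
    \<open>T\<close>.\<close>
  define w where "w j = cnj (S j) / of_real (norm (S j))" for j
  define u where "u j x = Re (w j * echar M (j * x))" for j x
  have half: "card T / 2 \<le> norm (S j)" if "j \<in> L" for j
  proof -
    have "(1 / 2)\<^sup>2 \<le> (norm (S j) / card T)\<^sup>2"
      using spec[OF that] by (simp add: spec_weight_def S_def power2_eq_square)
    hence "1 / 2 \<le> norm (S j) / card T" by (rule power2_le_imp_le) auto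
    thus ?thesis using c by (simp add: field_simps)
  qed
  have wn: "norm (w j) \<le> 1" for j by (auto simp: w_def norm_divide)
  have u1: "\<bar>u j x\<bar> \<le> 1" for j x
  proof -
    have "\<bar>u j x\<bar> \<le> norm (w j * echar M (j * x))" unfolding u_def by (rule abs_Re_le_cmod)
    also have "\<dots> \<le> 1" using wn by (simp add: norm_mult)
    finally show ?thesis .
  qed
  have uT: "card T / 2 \<le> (\<Sum>t\<in>T. u j t)" if "j \<in> L" for j
  proof -
    have "(\<Sum>t\<in>T. u j t) = Re (w j * S j)"
      by (simp only: u_def S_def sum_distrib_left Re_sum)
    also have "w j * S j = S j * cnj (S j) / of_real (norm (S j))" by (simp add: w_def)
    also have "\<dots> = of_real ((norm (S j))\<^sup>2 / norm (S j))"
      by (simp only: complex_norm_square[symmetric] of_real_divide)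
    also have "(norm (S j))\<^sup>2 / norm (S j) = norm (S j)" by (simp add: power2_eq_square)
    finally show ?thesis using half[OF that] by simp
  qed
  \<comment> \<open>From ln (1 + t) \<ge> t - 2 t^2 at t = u/8. With the mean of \<open>u j\<close>
    over \<open>T\<close> at least 1/2, each frequency then contributes at least 1/16 - 1/32 = 1/32
    to the mean exponent.\<close>
  have low: "exp (\<Sum>j\<in>L. u j x / 8 - 1 / 32) \<le> (\<Prod>j\<in>L. 1 + 1 / 8 * u j x)" for x
  proof -
    have "exp (u j x / 8 - 1 / 32) \<le> 1 + 1 / 8 * u j x" for j
    proof -
      have "\<bar>u j x / 8\<bar> \<le> 1 / 2" using u1[of j x] by simp
      hence "\<bar>ln (1 + u j x / 8) - u j x / 8\<bar> \<le> 2 * (u j x / 8)\<^sup>2" by (rule abs_ln_one_plus_x_minus_x_bound)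
      also have "\<dots> \<le> 1 / 32" using u1[of j x] by (simp add: power_divide abs_square_le_1)
      finally have "u j x / 8 - 1 / 32 \<le> ln (1 + u j x / 8)" by linarith
      hence "exp (u j x / 8 - 1 / 32) \<le> exp (ln (1 + u j x / 8))" by simp
      also have "\<dots> = 1 + u j x / 8" using u1[of j x] by (intro exp_ln) linarith
      finally show ?thesis by simp
    qed
    thus ?thesis unfolding exp_sum[OF fin] by (intro prod_mono) auto
  qed
  have "card T * (card L / 32) = (\<Sum>j\<in>L. card T / 2 / 8 - card T / 32)" by simp
  also have "\<dots> \<le> (\<Sum>j\<in>L. (\<Sum>t\<in>T. u j t) / 8 - card T / 32)"
    by (intro sum_mono diff_right_mono divide_right_mono uT) auto
  also have "\<dots> = (\<Sum>j\<in>L. \<Sum>t\<in>T. u j t / 8 - 1 / 32)"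
    by (simp add: sum_subtractf sum_divide_distrib)
  also have "\<dots> = (\<Sum>t\<in>T. \<Sum>j\<in>L. u j t / 8 - 1 / 32)" by (rule sum.swap)
  finally have "card L / 32 \<le> (\<Sum>t\<in>T. \<Sum>j\<in>L. u j t / 8 - 1 / 32) / card T"
    using c by (simp add: field_simps)
  hence "card T * exp (card L / 32) \<le> card T * exp ((\<Sum>t\<in>T. \<Sum>j\<in>L. u j t / 8 - 1 / 32) / card T)"
    by (intro mult_left_mono) auto
  also have "\<dots> \<le> (\<Sum>t\<in>T. exp (\<Sum>j\<in>L. u j t / 8 - 1 / 32))"
    by (rule exp_mean_le[OF finT T(2)])
  also have "\<dots> \<le> (\<Sum>t\<in>T. \<Prod>j\<in>L. 1 + 1 / 8 * u j t)"
    by (intro sum_mono low)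
  \<comment> \<open>All factors are positive, so the sum may be enlarged from \<open>T\<close> to
    the whole period, where the Riesz product has sum \<open>M\<close>.\<close>
  also have "\<dots> \<le> (\<Sum>x\<in>?Z. \<Prod>j\<in>L. 1 + 1 / 8 * u j x)"
    by (intro sum_mono2 T(1) order.trans[OF exp_ge_zero low]) auto
  also have "\<dots> = M" unfolding u_def by (rule riesz_product_sum[OF M fin dis])
  finally have "exp (card L / 32) \<le> M / card T" using c by (simp add: field_simps)
  thus ?thesis using M c by (subst ln_ge_iff) auto
qed

text \<open>A maximal dissociated subset \<open>L\<close> of the large spectrum spans it with
  coefficients -1, 0, 1. The spanning is recorded through its consequence for distances from 1: a
  point nearly annihilated by \<open>L\<close> is nearly annihilated by the whole spectrum.\<close>

lemma chang:
  assumes M: "M > 0" and T: "T \<subseteq> {0..<int M}" "T \<noteq> {}"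
  obtains L where "finite L" "card L / 32 \<le> ln (M / card T)"
    "\<And>r x. r \<in> {0..<int M} \<Longrightarrow> 1 / 4 \<le> spec_weight M T r \<Longrightarrow>
      norm (echar M (r * x) - 1) \<le> (\<Sum>j\<in>L. norm (echar M (j * x) - 1))"
proof -
  let ?Z = "{0..<int M}"
  define R where "R = {r \<in> ?Z. 1 / 4 \<le> spec_weight M T r}"
  have finR: "finite R" unfolding R_def by (rule finite_subset[of _ ?Z]) auto
  define D where "D = {L. L \<subseteq> R \<and> dissociated M L}"
  have "finite D" using finR by (auto simp: D_def)
  moreover have "{} \<in> D" by (auto simp: D_def dissociated_def)
  ultimately obtain L where L: "L \<in> D" and max: "\<And>L'. L' \<in> D \<Longrightarrow> L \<subseteq> L' \<Longrightarrow> L' = L"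
    using finite_has_maximal[of D] by blast
  have LR: "L \<subseteq> R" and dis: "dissociated M L" using L by (auto simp: D_def)
  have fin: "finite L" using LR finR finite_subset by blast
  have "card L / 32 \<le> ln (M / card T)"
    using LR by (intro dissociated_spectrum_card M T fin dis) (auto simp: R_def)
  moreover have "norm (echar M (r * x) - 1) \<le> (\<Sum>j\<in>L. norm (echar M (j * x) - 1))" if r: "r \<in> R" for r x
  proof (cases "r \<in> L")
    case True
    thus ?thesis by (intro member_le_sum fin) auto
  next
    case False
    have "\<not> dissociated M (insert r L)"
      using max[of "insert r L"] False LR r by (auto simp: D_def)
    then obtain \<epsilon> where \<epsilon>: "\<forall>j\<in>insert r L. \<epsilon> j \<in> {-1, 0, 1}" "int M dvd (\<Sum>j\<in>insert r L. \<epsilon> j * j)"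
      and nz: "\<exists>j\<in>insert r L. \<epsilon> j \<noteq> 0" unfolding dissociated_def by blast
    have dv: "int M dvd \<epsilon> r * r + (\<Sum>j\<in>L. \<epsilon> j * j)" using \<epsilon>(2) fin False by simp
    \<comment> \<open>Otherwise the nontrivial relation supplied by maximality would lie inside
      \<open>L\<close>. A coefficient of modulus 1 lets it be solved for \<open>r\<close>.\<close>
    have "\<epsilon> r \<noteq> 0"
    proof
      assume 0: "\<epsilon> r = 0"
      hence "int M dvd (\<Sum>j\<in>L. \<epsilon> j * j)" using dv by simp
      moreover have "\<forall>j\<in>L. \<epsilon> j \<in> {-1, 0, 1}" using \<epsilon>(1) by blast
      ultimately have "\<forall>j\<in>L. \<epsilon> j = 0" using dis unfolding dissociated_def by blast
      thus False using nz 0 by blast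
    qed
    hence er: "\<epsilon> r = 1 \<or> \<epsilon> r = -1" using \<epsilon>(1) by blast
    have sgn: "norm (echar M (\<epsilon> j * j * x) - 1) \<le> norm (echar M (j * x) - 1)" if "j \<in> L" for j
    proof -
      have "\<epsilon> j \<in> {-1, 0, 1}" using \<epsilon>(1) that by blast
      thus ?thesis by (auto simp: norm_echar_diff_1_uminus)
    qed
    define s where "s = (\<Sum>j\<in>L. \<epsilon> j * j * x)"
    have "int M dvd (\<epsilon> r * r + (\<Sum>j\<in>L. \<epsilon> j * j)) * x" using dv by simp
    hence "int M dvd \<epsilon> r * r * x + s" by (simp add: s_def distrib_right sum_distrib_right)
    hence one: "echar M (\<epsilon> r * r * x) * echar M s = 1"
      using M by (simp add: echar_eq_1_iff flip: echar_add)
    have "echar M (\<epsilon> r * r * x) = echar M (- s)"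
    proof -
      have "echar M s * echar M (- s) = 1" by (simp flip: echar_add)
      thus ?thesis using one by (metis mult.assoc mult.commute mult.right_neutral)
    qed
    moreover have "norm (echar M (r * x) - 1) = norm (echar M (\<epsilon> r * r * x) - 1)"
      using er by (auto simp: norm_echar_diff_1_uminus)
    ultimately have "norm (echar M (r * x) - 1) = norm (echar M s - 1)"
      by (simp add: norm_echar_diff_1_uminus)
    also have "\<dots> \<le> (\<Sum>j\<in>L. norm (echar M (\<epsilon> j * j * x) - 1))"
      unfolding s_def by (rule norm_echar_diff_1_sum[OF fin])
    also have "\<dots> \<le> (\<Sum>j\<in>L. norm (echar M (j * x) - 1))" by (intro sum_mono sgn)
    finally show ?thesis .
  qed
  ultimately show ?thesis using that[of L] fin by (auto simp: R_def)
qed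

section \<open>Smoothing\<close>

lemma diff_avg_periodic:
  assumes per: "\<And>x. f (x mod int M) = f x"
  shows "diff_avg T f (x mod int M) = diff_avg T f x"
proof -
  have "f (x mod int M + a) = f (x + a)" for a
    by (metis per mod_add_left_eq)
  thus ?thesis by (simp add: diff_avg_def)
qed

lemma diff_avg_mono: "(\<And>x. f x \<le> g x) \<Longrightarrow> diff_avg T f x \<le> diff_avg T g x"
  unfolding diff_avg_def by (intro divide_right_mono sum_mono) auto

lemma diff_avg_nonneg: "(\<And>x. 0 \<le> f x) \<Longrightarrow> 0 \<le> diff_avg T f x"
  unfolding diff_avg_def by (intro divide_nonneg_nonneg sum_nonneg) auto

lemma diff_avg_diff: "diff_avg T (\<lambda>x. f x - g x) x = diff_avg T f x - diff_avg T g x"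
  by (simp add: diff_avg_def sum_subtractf diff_divide_distrib)

lemma diff_avg_const_add:
  assumes "finite T" "T \<noteq> {}"
  shows "diff_avg T (\<lambda>x. c + f x) x = c + diff_avg T f x"
proof -
  have "card T \<noteq> 0" using assms by simp
  thus ?thesis by (simp add: diff_avg_def sum.distrib add_divide_distrib power2_eq_square)
qed

lemma abs_diff_avg_le: "\<bar>diff_avg T f x\<bar> \<le> diff_avg T (\<lambda>x. \<bar>f x\<bar>) x"
proof -
  have "\<bar>\<Sum>s\<in>T. \<Sum>t\<in>T. f (x + (s - t))\<bar> \<le> (\<Sum>s\<in>T. \<Sum>t\<in>T. \<bar>f (x + (s - t))\<bar>)"
    by (rule order.trans[OF sum_abs]) (intro sum_mono sum_abs)
  thus ?thesis unfolding diff_avg_def by (simp add: divide_right_mono)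
qed

lemma sum_diff_avg:
  assumes T: "finite T" "T \<noteq> {}" and per: "\<And>x. f (x mod int M) = f x"
  shows "(\<Sum>x\<in>{0..<int M}. diff_avg T f x) = (\<Sum>x\<in>{0..<int M}. f x)"
proof -
  let ?Z = "{0..<int M}"
  have "card T \<noteq> 0" using T by simp
  have "(\<Sum>x\<in>?Z. \<Sum>s\<in>T. \<Sum>t\<in>T. f (x + (s - t))) = (\<Sum>s\<in>T. \<Sum>x\<in>?Z. \<Sum>t\<in>T. f (x + (s - t)))"
    by (rule sum.swap)
  also have "\<dots> = (\<Sum>s\<in>T. \<Sum>t\<in>T. \<Sum>x\<in>?Z. f (x + (s - t)))"
    by (intro sum.cong refl sum.swap)
  also have "\<dots> = (\<Sum>s\<in>T. \<Sum>t\<in>T. \<Sum>x\<in>?Z. f x)"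
    by (intro sum.cong refl sum_shift_periodic per)
  also have "\<dots> = (real (card T))\<^sup>2 * (\<Sum>x\<in>?Z. f x)" by (simp add: power2_eq_square)
  finally show ?thesis
    using \<open>card T \<noteq> 0\<close> by (simp add: diff_avg_def flip: sum_divide_distrib)
qed

text \<open>The error has a uniform part and a part \<open>W\<close> of small total mass. A further
  averaging preserves constants and the mass of \<open>W\<close>, so each step adds only \<delta>
  and the mass of \<open>e\<close>.\<close>

lemma diff_avg_funpow_error:
  assumes T: "finite T" "T \<noteq> {}" 
    and eper: "\<And>x. e (x mod int M) = e x" and e0: "\<And>x. 0 \<le> e x"
    and err: "\<And>x. \<bar>diff_avg T F x - F x\<bar> \<le> \<delta> + e x"
  obtains W where "\<And>x. W (x mod int M) = W x" "\<And>x. 0 \<le> W x"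
    "(\<Sum>x\<in>{0..<int M}. W x) = real l * (\<Sum>x\<in>{0..<int M}. e x)"
    "\<And>x. \<bar>(diff_avg T ^^ l) F x - F x\<bar> \<le> real l * \<delta> + W x"
proof (induction l arbitrary: thesis)
  case 0
  show ?case by (rule 0[of "\<lambda>_. 0"]) auto
next
  case (Suc l)
  obtain W where W: "\<And>x. W (x mod int M) = W x" "\<And>x. 0 \<le> W x"
    "(\<Sum>x\<in>{0..<int M}. W x) = real l * (\<Sum>x\<in>{0..<int M}. e x)"
    "\<And>x. \<bar>(diff_avg T ^^ l) F x - F x\<bar> \<le> real l * \<delta> + W x"
    using Suc.IH by blast
  let ?U = "diff_avg T"
  show ?case
  proof (rule Suc.prems[of "\<lambda>x. ?U W x + e x"])
    fix x
    show "?U W (x mod int M) + e (x mod int M) = ?U W x + e x"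
      by (simp add: eper diff_avg_periodic[of W, OF W(1)])
    show "0 \<le> ?U W x + e x" using diff_avg_nonneg[of W, OF W(2)] e0 by (simp add: add_nonneg_nonneg)
    have "\<bar>?U ((?U ^^ l) F) x - ?U F x\<bar> = \<bar>?U (\<lambda>x. (?U ^^ l) F x - F x) x\<bar>" by (simp add: diff_avg_diff)
    also have "\<dots> \<le> ?U (\<lambda>x. \<bar>(?U ^^ l) F x - F x\<bar>) x" by (rule abs_diff_avg_le)
    also have "\<dots> \<le> ?U (\<lambda>x. real l * \<delta> + W x) x" by (rule diff_avg_mono) (rule W)
    also have "\<dots> = real l * \<delta> + ?U W x" by (rule diff_avg_const_add[OF T])
    finally have "\<bar>?U ((?U ^^ l) F) x - F x\<bar> \<le> real l * \<delta> + ?U W x + (\<delta> + e x)"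
      using err[of x] by linarith
    thus "\<bar>(?U ^^ Suc l) F x - F x\<bar> \<le> real (Suc l) * \<delta> + (?U W x + e x)"
      by (simp add: algebra_simps)
  next
    show "(\<Sum>x\<in>{0..<int M}. ?U W x + e x) = real (Suc l) * (\<Sum>x\<in>{0..<int M}. e x)"
      by (simp add: sum.distrib sum_diff_avg[of T W, OF T W(1)] W(3) algebra_simps)
  qed
qed

text \<open>Turns the exceptional sets of individual shifts into one error function:
  \<open>e x\<close> is the proportion of pairs \<open>(s, t)\<close> for which \<open>x\<close> is
  exceptional. As the convolution takes values in [0,1], an exceptional pair costs at most 1;
  swapping sums bounds the mass of \<open>e\<close>.\<close>

lemma avg_shift_smooth:
  fixes f :: "int \<Rightarrow> real" and \<epsilon> \<eta> :: real
  assumes M: "M > 0" and per: "\<And>x. f (x mod int M) = f x"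
    and f: "\<And>x. 0 \<le> f x" "\<And>x. f x \<le> 1"
    and T: "finite T" "T \<noteq> {}" and e: "0 < \<epsilon>"
    and almost: "\<And>s t. s \<in> T \<Longrightarrow> t \<in> T \<Longrightarrow>
      card {x \<in> {0..<int M}. \<epsilon> < \<bar>avg_shift A f (x + (s - t)) - avg_shift A f x\<bar>} \<le> \<eta> * M"
  obtains W where "\<And>x. W (x mod int M) = W x" "\<And>x. 0 \<le> W x"
    "(\<Sum>x\<in>{0..<int M}. W x) \<le> real l * \<eta> * M"
    "\<And>x. \<bar>(diff_avg T ^^ l) (avg_shift A f) x - avg_shift A f x\<bar> \<le> real l * \<epsilon> + W x"
proof -
  let ?Z = "{0..<int M}"
  define F where "F = avg_shift A f"
  have cT: "card T > 0" using T by (simp add: card_gt_0_iff)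
  have Fper: "F (x mod int M) = F x" for x unfolding F_def by (rule avg_shift_periodic) (rule per)
  have Fb: "0 \<le> F x" "F x \<le> 1" for x unfolding F_def by (rule avg_shift_bounds[OF f])+
  define i where "i x a = (if \<epsilon> < \<bar>F (x + a) - F x\<bar> then 1 else 0 :: real)" for x a
  define e where "e x = (\<Sum>s\<in>T. \<Sum>t\<in>T. i x (s - t)) / (real (card T))\<^sup>2" for x
  have e0: "0 \<le> e x" for x unfolding e_def i_def by (intro divide_nonneg_nonneg sum_nonneg) auto
  have eper: "e (x mod int M) = e x" for x
  proof -
    have "F (x mod int M + a) = F (x + a)" for a by (metis Fper mod_add_left_eq)
    thus ?thesis by (simp add: e_def i_def Fper)
  qed
  have err: "\<bar>diff_avg T F x - F x\<bar> \<le> \<epsilon> + e x" for x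
  proof -
    have "diff_avg T F x - F x = (\<Sum>s\<in>T. \<Sum>t\<in>T. F (x + (s - t)) - F x) / (real (card T))\<^sup>2"
      using cT by (simp add: diff_avg_def sum_subtractf diff_divide_distrib power2_eq_square)
    also have "\<bar>\<dots>\<bar> \<le> (\<Sum>s\<in>T. \<Sum>t\<in>T. \<epsilon> + i x (s - t)) / (real (card T))\<^sup>2"
      unfolding abs_divide
    proof (rule frac_le)
      have "\<bar>F (x + a) - F x\<bar> \<le> \<epsilon> + i x a" for a
        unfolding i_def using Fb[of "x + a"] Fb[of x] e by auto
      thus "\<bar>\<Sum>s\<in>T. \<Sum>t\<in>T. F (x + (s - t)) - F x\<bar> \<le> (\<Sum>s\<in>T. \<Sum>t\<in>T. \<epsilon> + i x (s - t))"
        by (intro order.trans[OF sum_abs] sum_mono)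
      thus "0 \<le> (\<Sum>s\<in>T. \<Sum>t\<in>T. \<epsilon> + i x (s - t))" by linarith
    qed (use cT in auto)
    also have "\<dots> = \<epsilon> + e x"
      using cT by (simp add: e_def sum.distrib add_divide_distrib power2_eq_square)
    finally show ?thesis .
  qed
  have esum: "(\<Sum>x\<in>?Z. e x) \<le> \<eta> * M"
  proof -
    have "(\<Sum>x\<in>?Z. \<Sum>s\<in>T. \<Sum>t\<in>T. i x (s - t)) = (\<Sum>s\<in>T. \<Sum>x\<in>?Z. \<Sum>t\<in>T. i x (s - t))"
      by (rule sum.swap)
    also have "\<dots> = (\<Sum>s\<in>T. \<Sum>t\<in>T. \<Sum>x\<in>?Z. i x (s - t))"
      by (intro sum.cong refl sum.swap)
    also have "\<dots> \<le> (\<Sum>s\<in>T. \<Sum>t\<in>T. \<eta> * M)"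
    proof (intro sum_mono)
      fix s t assume st: "s \<in> T" "t \<in> T"
      have "(\<Sum>x\<in>?Z. i x (s - t)) = card {x \<in> ?Z. \<epsilon> < \<bar>F (x + (s - t)) - F x\<bar>}"
        unfolding i_def by (simp add: sum.If_cases Int_def)
      thus "(\<Sum>x\<in>?Z. i x (s - t)) \<le> \<eta> * M" using almost[OF st] by (simp add: F_def)
    qed
    also have "\<dots> = (real (card T))\<^sup>2 * (\<eta> * M)" by (simp add: power2_eq_square)
    finally have "(\<Sum>x\<in>?Z. \<Sum>s\<in>T. \<Sum>t\<in>T. i x (s - t)) / (real (card T))\<^sup>2 \<le> \<eta> * M"
      using cT by (simp add: divide_le_eq mult.commute)
    thus ?thesis unfolding e_def by (simp add: sum_divide_distrib)
  qed
  obtain W where W: "\<And>x. W (x mod int M) = W x" "\<And>x. 0 \<le> W x"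
    "(\<Sum>x\<in>?Z. W x) = real l * (\<Sum>x\<in>?Z. e x)"
    "\<And>x. \<bar>(diff_avg T ^^ l) F x - F x\<bar> \<le> real l * \<epsilon> + W x"
    using diff_avg_funpow_error[OF T, of e M F \<epsilon> l] eper e0 err by blast
  have "real l * (\<Sum>x\<in>?Z. e x) \<le> real l * (\<eta> * M)" by (intro mult_left_mono esum) auto
  with W that[of W] show ?thesis by (simp add: F_def mult.assoc)
qed

text \<open>Outside the large spectrum the multiplier is at most 4^-l and the character moves by at
  most 2; inside, the multiplier is at most 1 and the character moves by at most \<rho>. The
  absolute sum of the coefficients comes from \<open>avg_shift_fourier\<close>.\<close>

lemma diff_avg_funpow_shift:
  fixes f :: "int \<Rightarrow> real"
  assumes M: "M > 0" and per: "\<And>x. f (x mod int M) = f x"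
    and f: "\<And>x. \<bar>f x\<bar> \<le> 1" and A: "A \<subseteq> {0..<int M}" "A \<noteq> {}"
    and \<rho>: "0 \<le> \<rho>" "\<And>r. r \<in> {0..<int M} \<Longrightarrow> 1 / 4 \<le> spec_weight M T r \<Longrightarrow> norm (echar M (r * p) - 1) \<le> \<rho>"
  shows "\<bar>(diff_avg T ^^ l) (avg_shift A f) (x + p) - (diff_avg T ^^ l) (avg_shift A f) x\<bar>
    \<le> sqrt (M / card A) * (2 / 4 ^ l + \<rho>)"
proof -
  let ?Z = "{0..<int M}"
  let ?G = "(diff_avg T ^^ l) (avg_shift A f)"
  let ?s = "spec_weight M T"
  obtain c where c: "\<And>x. complex_of_real (avg_shift A f x) = (\<Sum>r\<in>?Z. c r * echar M (r * x))"
    and cn: "(\<Sum>r\<in>?Z. norm (c r)) \<le> sqrt (real M / card A)"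
    using avg_shift_fourier[of M f A] M per f A by blast
  have G: "complex_of_real (?G x) = (\<Sum>r\<in>?Z. (c r * of_real (?s r ^ l)) * echar M (r * x))" for x
    by (rule diff_avg_funpow_fourier[of "avg_shift A f", OF c])
  have "complex_of_real (?G (x + p) - ?G x)
      = (\<Sum>r\<in>?Z. (c r * of_real (?s r ^ l)) * echar M (r * x) * (echar M (r * p) - 1))"
    by (simp only: of_real_diff G sum_subtractf[symmetric]) (simp add: distrib_left echar_add algebra_simps)
  hence "\<bar>?G (x + p) - ?G x\<bar> = norm (\<Sum>r\<in>?Z. (c r * of_real (?s r ^ l)) * echar M (r * x) * (echar M (r * p) - 1))"
    by (metis norm_of_real real_norm_def)
  also have "\<dots> \<le> (\<Sum>r\<in>?Z. norm ((c r * of_real (?s r ^ l)) * echar M (r * x) * (echar M (r * p) - 1)))"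
    by (rule norm_sum)
  also have "\<dots> \<le> (\<Sum>r\<in>?Z. norm (c r) * (2 / 4 ^ l + \<rho>))"
  proof (rule sum_mono)
    fix r assume r: "r \<in> ?Z"
    have s: "0 \<le> ?s r ^ l" "?s r ^ l \<le> 1"
      using spec_weight_nonneg spec_weight_le_1 by (auto intro!: power_le_one)
    have n2: "norm (echar M (r * p) - 1) \<le> 2"
      using norm_triangle_ineq4[of "echar M (r * p)" 1] by simp
    have "?s r ^ l * norm (echar M (r * p) - 1) \<le> 2 / 4 ^ l + \<rho>"
    proof (cases "1 / 4 \<le> ?s r")
      case True
      have "?s r ^ l * norm (echar M (r * p) - 1) \<le> 1 * \<rho>"
        using s \<rho>(2)[OF r True] by (intro mult_mono) auto
      thus ?thesis by (simp add: add_increasing)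
    next
      case False
      have "?s r ^ l \<le> (1 / 4) ^ l" using False spec_weight_nonneg by (intro power_mono) auto
      hence "?s r ^ l * norm (echar M (r * p) - 1) \<le> (1 / 4) ^ l * 2"
        using s n2 by (intro mult_mono) auto
      thus ?thesis using \<rho>(1) by (simp add: power_divide)
    qed
    hence "norm (c r) * (?s r ^ l * norm (echar M (r * p) - 1)) \<le> norm (c r) * (2 / 4 ^ l + \<rho>)"
      by (rule mult_left_mono) simp
    thus "norm ((c r * of_real (?s r ^ l)) * echar M (r * x) * (echar M (r * p) - 1)) \<le> norm (c r) * (2 / 4 ^ l + \<rho>)"
      by (simp add: norm_mult mult.assoc norm_power spec_weight_nonneg)
  qed
  also have "\<dots> = (\<Sum>r\<in>?Z. norm (c r)) * (2 / 4 ^ l + \<rho>)" by (simp add: sum_distrib_right)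
  also have "\<dots> \<le> sqrt (M / card A) * (2 / 4 ^ l + \<rho>)"
    using \<rho>(1) by (intro mult_right_mono cn) auto
  finally show ?thesis .
qed

section \<open>Progressions in sumsets\<close>

text \<open>Pigeonhole over the at most \<open>2 * N\<close> values of a + c; the pairs with a given
  sum are determined by their first entry.\<close>

lemma exists_popular_sum:
  fixes A C :: "int set"
  assumes N: "N \<ge> 1" and A: "A \<subseteq> {1..int N}" "A \<noteq> {}" and C: "C \<subseteq> {1..int N}" "C \<noteq> {}"
  obtains z where "z \<in> {1..2 * int N}" "card A * card C \<le> card {a \<in> A. z - a \<in> C} * (2 * N)"
proof -
  have fin: "finite A" "finite C" using A C finite_subset by blast+
  define \<phi> where "\<phi> = (\<lambda>(a, c). a + c :: int)"
  have maps: "\<phi> \<in> A \<times> C \<rightarrow> {1..2 * int N}" using A C by (fastforce simp: \<phi>_def)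
  have fins: "finite (A \<times> C)" "finite {1..2 * int N}" using fin by auto
  have ne: "{1..2 * int N} \<noteq> {}" using N by auto
  obtain z where z: "z \<in> {1..2 * int N}"
    "card (A \<times> C) \<le> card (\<phi> -` {z} \<inter> (A \<times> C)) * card {1..2 * int N}"
    using pigeonhole_card[OF maps fins ne] by blast
  have "\<phi> -` {z} \<inter> (A \<times> C) \<subseteq> (\<lambda>a. (a, z - a)) ` {a \<in> A. z - a \<in> C}"
    by (auto simp: \<phi>_def image_iff)
  hence "card (\<phi> -` {z} \<inter> (A \<times> C)) \<le> card {a \<in> A. z - a \<in> C}"
    using fin by (intro surj_card_le) auto
  hence "card (\<phi> -` {z} \<inter> (A \<times> C)) * card {1..2 * int N} \<le> card {a \<in> A. z - a \<in> C} * (2 * N)"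
    by (simp add: nat_mult_distrib)
  with z that show ?thesis by (simp add: card_cartesian_product)
qed

text \<open>Dirichlet's theorem for the fractions x/M with \<open>x\<close> in \<open>L\<close>
  moves each character by at most 2 pi/Q, and the multiple \<open>j * s\<close> costs a factor
  \<open>j\<close>. The bound on \<open>s\<close> later keeps the whole progression short.\<close>

lemma exists_bohr_step:
  fixes L :: "int set"
  assumes M: "M > 0" and Q: "Q > 0" and fin: "finite L" and d: "card L \<le> d"
  obtains s :: int where "0 < s" "s \<le> int (Q ^ d)"
    "\<And>j. (\<Sum>x\<in>L. norm (echar M (x * (int j * s)) - 1)) \<le> real d * (real j * (2 * pi / Q))"
proof -
  obtain h where h: "bij_betw h {0..<card L} L" using ex_bij_betw_nat_finite[OF fin] by blast
  obtain s p where s: "0 < s" "s \<le> int (Q ^ card L)"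
    and sp: "\<And>i. i < card L \<Longrightarrow> \<bar>of_int s * (of_int (h i) / real M) - of_int (p i)\<bar> < 1 / Q"
    using Dirichlet_approx_simult[OF Q, of "card L" "\<lambda>i. of_int (h i) / real M"] by metis
  have one: "norm (echar M (x * s) - 1) \<le> 2 * pi / Q" if x: "x \<in> L" for x
  proof -
    obtain i where i: "i < card L" "h i = x" using x h unfolding bij_betw_def by (metis atLeastLessThan_iff imageE)
    have "norm (echar M (x * s) - 1) \<le> 2 * pi * \<bar>of_int (x * s) / of_nat M - of_int (p i)\<bar>"
      by (rule norm_echar_diff_1_le[OF M])
    also have "\<dots> \<le> 2 * pi * (1 / Q)"
      using sp[OF i(1)] i(2) by (intro mult_left_mono less_imp_le) (auto simp: mult.commute)
    finally show ?thesis by simp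
  qed
  have "(\<Sum>x\<in>L. norm (echar M (x * (int j * s)) - 1)) \<le> real d * (real j * (2 * pi / Q))" for j
  proof -
    have "(\<Sum>x\<in>L. norm (echar M (x * (int j * s)) - 1)) \<le> (\<Sum>x\<in>L. real j * (2 * pi / Q))"
    proof (rule sum_mono)
      fix x assume x: "x \<in> L"
      have "norm (echar M (int j * (x * s)) - 1) \<le> real j * norm (echar M (x * s) - 1)"
        by (rule norm_echar_diff_1_mult_nat)
      also have "\<dots> \<le> real j * (2 * pi / Q)" by (intro mult_left_mono one x) auto
      finally show "norm (echar M (x * (int j * s)) - 1) \<le> real j * (2 * pi / Q)"
        by (simp add: mult_ac)
    qed
    also have "\<dots> = real (card L) * (real j * (2 * pi / Q))" by simp
    also have "\<dots> \<le> real d * (real j * (2 * pi / Q))" using d by (intro mult_right_mono) auto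
    finally show ?thesis .
  qed
  moreover have "Q ^ card L \<le> Q ^ d" using Q d by (intro power_increasing) auto
  hence "s \<le> int (Q ^ d)" using s(2) by linarith
  ultimately show ?thesis using s(1) that by blast
qed

text \<open>The modulus \<open>4 N\<close> is large enough that congruences between the sums involved are equalities.\<close>

lemma progression_in_sumset:
  fixes A B C :: "int set" and N k l n d Q :: nat
  defines "a0 \<equiv> real (card A) * real (card C) / (8 * (real N)\<^sup>2)"
  assumes N: "N \<ge> 1"
    and A: "A \<subseteq> {1..int N}" "A \<noteq> {}" and B: "B \<subseteq> {1..int N}" "B \<noteq> {}" and C: "C \<subseteq> {1..int N}" "C \<noteq> {}"
    and pos: "k > 0" "l > 0" "n > 0" "Q > 0"
    and l: "40 \<le> 4 ^ l * sqrt a0"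
    and n: "4 * exp (- (n / (1600 * (real l)\<^sup>2))) \<le> card B / (8000 * real N * k * l)"
    and d: "32 * (ln 2 + n * ln (2 / a0)) \<le> d"
    and Q: "130 * real k * d \<le> Q * sqrt a0"
    and k: "k * Q ^ d \<le> N"
  shows "\<exists>X P. X \<subseteq> B \<and> 0.99 * real (card B) \<le> card X \<and> is_AP P k \<and> X + P \<subseteq> A + B + C"
proof -
  have finA: "finite A" and finB: "finite B" and finC: "finite C" using A B C finite_subset by blast+
  have cards: "card A > 0" "card B > 0" "card C > 0" using A B C finA finB finC by (auto simp: card_gt_0_iff)
  have a0: "a0 > 0" using cards N by (simp add: a0_def)
  define M where "M = 4 * N"
  let ?Z = "{0..<int M}"
  have M: "M > 0" using N by (simp add: M_def)
  obtain z where z: "z \<in> {1..2 * int N}" and zcard: "card A * card C \<le> card {a \<in> A. z - a \<in> C} * (2 * N)"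
    by (rule exists_popular_sum[OF N A C])
  \<comment> \<open>For \<open>a\<close> in \<open>A'\<close> the point z + b - a lies in B + C,
    which will make the convolution equal to 1 on z + B.\<close>
  define A' where "A' = {a \<in> A. z - a \<in> C}"
  have A'A: "A' \<subseteq> A" by (auto simp: A'_def)
  have A'Z: "A' \<subseteq> ?Z" using A'A A(1) by (fastforce simp: M_def)
  have cA'0: "card A' > 0"
  proof (rule ccontr)
    assume "\<not> card A' > 0"
    hence "card A * card C \<le> 0" using zcard by (simp add: A'_def)
    thus False using cards by simp
  qed
  hence A'ne: "A' \<noteq> {}" by auto
  \<comment> \<open>The popular sum costs a factor \<open>2 * N\<close> and the density is taken
    relative to \<open>4 * N\<close>; this is the 8 N^2 in \<open>a0\<close>.\<close>
  have dens: "a0 \<le> card A' / M"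
  proof -
    have "real (card A) * card C \<le> card A' * (2 * N)"
      using zcard unfolding A'_def by (metis of_nat_le_iff of_nat_mult)
    thus ?thesis using N by (simp add: a0_def M_def field_simps power2_eq_square)
  qed
  define f where "f x = (if \<exists>b\<in>B. \<exists>c\<in>C. x mod int M = (b + c) mod int M then 1 else 0 :: real)" for x
  have per: "f (x mod int M) = f x" for x by (simp add: f_def)
  have f01: "0 \<le> f x" "f x \<le> 1" "\<bar>f x\<bar> \<le> 1" for x by (auto simp: f_def)
  define F where "F = avg_shift A' f"
  \<comment> \<open>With tolerance \<open>2 * \<epsilon>\<close>, smoothing \<open>l\<close> times
    costs 1/10 uniformly. The choice of \<eta> gives the error function mass at most |B|/(1000 k),
    so at level 1/10 each of the \<open>k\<close> shifts spoils at most |B|/(100 k) elements of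
    \<open>B\<close>.\<close>
  define \<epsilon> where "\<epsilon> = 1 / (20 * real l)"
  define \<eta> where "\<eta> = card B / (8000 * real N * k * l)"
  have \<epsilon>: "0 < \<epsilon>" "\<epsilon> \<le> 2" using pos by (auto simp: \<epsilon>_def field_simps)
  have \<eta>: "4 * exp (- (\<epsilon>\<^sup>2 * n / 4)) \<le> \<eta>"
    using n by (simp add: \<epsilon>_def \<eta>_def power_divide power_mult_distrib)
  obtain T where T: "T \<subseteq> ?Z" and cT: "(real (card A') / (2 * real M)) ^ n * M / 2 \<le> card T"
    and almost: "\<And>s t. s \<in> T \<Longrightarrow> t \<in> T \<Longrightarrow>
      card {x \<in> ?Z. 2 * \<epsilon> < \<bar>avg_shift A' f (x + (s - t)) - avg_shift A' f x\<bar>} \<le> 2 * \<eta> * M"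
    by (rule croot_sisask[where M = M and f = f, OF M per f01(1,2) A'Z A'ne \<epsilon> pos(3) \<eta>]) (rule that)
  have "0 < (real (card A') / (2 * real M)) ^ n * M / 2" using cA'0 M by simp
  hence cT0: "card T > 0" using cT by linarith
  hence Tne: "T \<noteq> {}" and finT: "finite T" using card_gt_0_iff by blast+
  obtain L where L: "finite L" "card L / 32 \<le> ln (M / card T)"
    and span: "\<And>r x. r \<in> ?Z \<Longrightarrow> 1 / 4 \<le> spec_weight M T r \<Longrightarrow>
      norm (echar M (r * x) - 1) \<le> (\<Sum>y\<in>L. norm (echar M (y * x) - 1))"
    using chang[OF M T Tne] by blast
  \<comment> \<open>The relative density of \<open>T\<close> is at least (a0/2)^n / 2, which makes
    the bound of \<open>chang\<close> the left side of the hypothesis on \<open>d\<close>.\<close>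
  have "card L \<le> d"
  proof -
    have "(a0 / 2) ^ n * M / 2 \<le> (real (card A') / (2 * real M)) ^ n * M / 2"
      using dens a0 by (intro divide_right_mono mult_right_mono power_mono) auto
    also note cT
    finally have "(a0 / 2) ^ n * M / 2 \<le> card T" .
    hence "M / card T \<le> 2 * (2 / a0) ^ n"
      using a0 cT0 by (simp add: field_simps power_divide)
    hence "ln (M / card T) \<le> ln (2 * (2 / a0) ^ n)"
      using M cT0 a0 by (subst ln_le_cancel_iff) auto
    also have "\<dots> = ln 2 + n * ln (2 / a0)" using a0 by (simp add: ln_mult ln_realpow)
    finally have up: "ln (M / card T) \<le> ln 2 + n * ln (2 / a0)" .
    have "real (card L) = 32 * (card L / 32)" by simp
    also have "\<dots> \<le> 32 * (ln 2 + n * ln (2 / a0))"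
      using L(2) up by (intro mult_left_mono) auto
    also note d
    finally show ?thesis by simp
  qed
  then obtain s where s: "0 < s" "s \<le> int (Q ^ d)"
    and bohr: "\<And>j. (\<Sum>y\<in>L. norm (echar M (y * (int j * s)) - 1)) \<le> real d * (real j * (2 * pi / Q))"
    using exists_bohr_step[OF M pos(4) L(1)] by blast
  have ks: "int k * s \<le> int N"
  proof -
    have "int k * s \<le> int k * int (Q ^ d)" using s by (intro mult_left_mono) auto
    also have "\<dots> \<le> int N" using k by (metis of_nat_le_iff of_nat_mult)
    finally show ?thesis .
  qed
  have js: "0 \<le> int j * s" "int j * s < int N" if "j < k" for j
  proof -
    show "0 \<le> int j * s" using s by simp
    have "int j * s < int k * s" using that s by simp
    thus "int j * s < int N" using ks by linarith
  qed
  define G where "G = (diff_avg T ^^ l) F"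
  have Gshift: "\<bar>G (x + int j * s) - G x\<bar> \<le> 1 / 5" if j: "j < k" for x j
  proof -
    define \<rho> where "\<rho> = real d * (real k * (2 * pi / Q))"
    have "\<bar>G (x + int j * s) - G x\<bar> \<le> sqrt (M / card A') * (2 / 4 ^ l + \<rho>)"
      unfolding G_def F_def
    proof (rule diff_avg_funpow_shift[where M = M and f = f, OF M per f01(3) A'Z A'ne])
      show "0 \<le> \<rho>" by (simp add: \<rho>_def)
      fix r assume "r \<in> ?Z" "1 / 4 \<le> spec_weight M T r"
      hence "norm (echar M (r * (int j * s)) - 1) \<le> (\<Sum>y\<in>L. norm (echar M (y * (int j * s)) - 1))"
        by (rule span)
      also have "\<dots> \<le> real d * (real j * (2 * pi / Q))" by (rule bohr)
      also have "\<dots> \<le> \<rho>" using j unfolding \<rho>_def by (intro mult_left_mono mult_right_mono) auto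
      finally show "norm (echar M (r * (int j * s)) - 1) \<le> \<rho>" .
    qed
    also have "sqrt (M / card A') \<le> sqrt (1 / a0)"
      using dens a0 M cA'0 by (intro real_sqrt_le_mono) (simp add: field_simps)
    hence "sqrt (M / card A') * (2 / 4 ^ l + \<rho>) \<le> sqrt (1 / a0) * (2 / 4 ^ l + \<rho>)"
      by (intro mult_right_mono) (auto simp: \<rho>_def)
    also have "\<dots> = 2 / (4 ^ l * sqrt a0) + 2 * pi * (k * d / (Q * sqrt a0))"
      using a0 by (simp add: real_sqrt_divide \<rho>_def field_simps)
    also have "\<dots> \<le> 2 / 40 + 2 * pi * (1 / 130)"
    proof (intro add_mono mult_left_mono)
      show "2 / (4 ^ l * sqrt a0) \<le> 2 / 40" using l by (intro divide_left_mono) auto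
      show "real (k * d) / (Q * sqrt a0) \<le> 1 / 130"
        using Q pos a0 by (simp add: field_simps)
    qed auto
    also have "\<dots> \<le> 1 / 5" using pi_less_4 by simp
    finally show ?thesis by simp
  qed
  obtain W where W: "\<And>x. W (x mod int M) = W x" "\<And>x. 0 \<le> W x"
    "(\<Sum>x\<in>?Z. W x) \<le> real l * (2 * \<eta>) * M"
    and WG: "\<And>x. \<bar>G x - F x\<bar> \<le> real l * (2 * \<epsilon>) + W x"
    unfolding G_def F_def
    using avg_shift_smooth[of M f T "2 * \<epsilon>" A' "2 * \<eta>" l] M per f01(1,2) finT Tne \<epsilon>(1) almost by auto
  have GF: "\<bar>G x - F x\<bar> \<le> 1 / 10 + W x" for x
    using WG[of x] pos by (simp add: \<epsilon>_def)
  define bad where "bad j = {b \<in> B. 1 / 10 < W (b + (z + int j * s))}" for j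
  have badcard: "real (card (bad j)) \<le> card B / (100 * k)" for j
  proof -
    have "bad j \<subseteq> {x \<in> ?Z. 1 / 10 < W (x + (z + int j * s))}"
      using B(1) by (fastforce simp: bad_def M_def)
    hence "card (bad j) \<le> card {x \<in> ?Z. 1 / 10 < W (x + (z + int j * s))}"
      by (rule card_mono[rotated]) (rule finite_subset[of _ ?Z], auto)
    also have "\<dots> = card {x \<in> ?Z. 1 / 10 < W x}"
      by (rule card_shift_periodic) (simp add: W)
    finally have "real (card (bad j)) * (1 / 10) \<le> real (card {x \<in> ?Z. 1 / 10 < W x}) * (1 / 10)" by simp
    also have "\<dots> \<le> (\<Sum>x\<in>?Z. W x)" by (rule card_markov) (auto simp: W)
    also note W(3)
    also have "real l * (2 * \<eta>) * M = card B / (1000 * k)"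
      using pos N by (simp add: \<eta>_def M_def field_simps)
    finally show ?thesis by simp
  qed
  define X where "X = B - (\<Union>j<k. bad j)"
  define P where "P = {z + int i * s | i. i < k}"
  have "X \<subseteq> B" by (auto simp: X_def)
  moreover have "0.99 * real (card B) \<le> card X"
  proof -
    have finU: "finite (\<Union>j<k. bad j)" using finB by (auto simp: bad_def)
    have "real (card (\<Union>j<k. bad j)) \<le> real (\<Sum>j<k. card (bad j))"
      by (simp only: of_nat_le_iff) (rule card_UN_le, simp)
    also have "\<dots> \<le> (\<Sum>j<k. card B / (100 * k))"
      unfolding of_nat_sum by (intro sum_mono badcard)
    also have "\<dots> = card B / 100" using pos by simp
    finally have "real (card (\<Union>j<k. bad j)) \<le> card B / 100" .
    moreover have "card B \<le> card X + card (\<Union>j<k. bad j)"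
      using diff_card_le_card_Diff[OF finU, of B] unfolding X_def by linarith
    hence "real (card B) \<le> card X + card (\<Union>j<k. bad j)" by linarith
    ultimately show ?thesis by simp
  qed
  moreover have "is_AP P k" unfolding is_AP_def P_def using s(1) by blast
  moreover have "X + P \<subseteq> A + B + C"
  proof
    fix y assume "y \<in> X + P"
    then obtain b i where b: "b \<in> X" and i: "i < k" and y: "y = b + (z + int i * s)"
      by (auto simp: set_plus_def P_def)
    have bB: "b \<in> B" using b by (simp add: X_def)
    have good: "W (b + (z + int j * s)) \<le> 1 / 10" if "j < k" for j
    proof -
      have "b \<notin> bad j" using b that by (auto simp: X_def)
      thus ?thesis using bB by (simp add: bad_def)
    qed
    have "f (b + z - a) = 1" if "a \<in> A'" for a
    proof -
      have "z - a \<in> C" using that by (simp add: A'_def)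
      moreover have "b + z - a = b + (z - a)" by simp
      ultimately show ?thesis using bB unfolding f_def by metis
    qed
    hence F1: "F (b + z) = 1" using cA'0 by (simp add: F_def avg_shift_def)
    \<comment> \<open>Three errors of at most 1/5 separate \<open>F y\<close> from
      \<open>F (b + z) = 1\<close>: unsmoothing at both points and the shift of \<open>G\<close>. So
      \<open>F y\<close> is positive and some \<open>y - a\<close> lies in B + C mod
      \<open>M\<close>.\<close>
    have "\<bar>G (b + z) - F (b + z)\<bar> \<le> 1 / 10 + 1 / 10"
      using GF[of "b + z"] good[of 0] pos(1) by simp
    moreover have "\<bar>G y - F y\<bar> \<le> 1 / 10 + 1 / 10" using GF[of y] good[OF i] by (simp add: y)
    moreover have "\<bar>G y - G (b + z)\<bar> \<le> 1 / 5" using Gshift[OF i, of "b + z"] by (simp add: y add.assoc)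
    ultimately have "F y \<noteq> 0" using F1 by linarith
    then obtain a where a: "a \<in> A'" "f (y - a) \<noteq> 0"
      unfolding F_def avg_shift_def by (metis div_0 sum.neutral)
    then obtain b' c where bc: "b' \<in> B" "c \<in> C" "(y - a) mod int M = (b' + c) mod int M"
      unfolding f_def by (metis (full_types))
    have dvd: "int M dvd (y - a) - (b' + c)" using bc(3) by (simp add: mod_eq_dvd_iff)
    \<comment> \<open>\<open>y\<close> lies strictly between 0 and \<open>4 * N\<close> since
      \<open>int i * s < N\<close>, while a + b' + c lies between 3 and
      \<open>3 * N\<close>.\<close>
    have small: "\<bar>(y - a) - (b' + c)\<bar> < int M"
    proof -
      have "1 \<le> a" "a \<le> int N" "1 \<le> b" "b \<le> int N" "1 \<le> b'" "b' \<le> int N" "1 \<le> c" "c \<le> int N"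
        using a(1) A'A A(1) B(1) C(1) bB bc by auto
      moreover have "1 \<le> z" "z \<le> 2 * int N" using z by auto
      ultimately show ?thesis using js[OF i] unfolding y M_def by (simp add: abs_less_iff)
    qed
    have "(y - a) - (b' + c) = 0"
    proof (rule ccontr)
      assume "(y - a) - (b' + c) \<noteq> 0"
      thus False using dvd_imp_le_int[OF _ dvd] small by simp
    qed
    hence "y = a + b' + c" by simp
    thus "y \<in> A + B + C" using a(1) A'A bc by (auto simp: set_plus_def)
  qed
  ultimately show ?thesis by blast
qed

section \<open>Choice of parameters\<close>

lemma nat_ceiling_bounds:
  fixes x :: real
  assumes "0 \<le> x"
  shows "x \<le> real (nat \<lceil>x\<rceil>)" "real (nat \<lceil>x\<rceil>) \<le> x + 1"
  using assms by linarith+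

text \<open>The constraints force l ~ L, n ~ L^2 H, d ~ L^3 H and Q ~ k d exp (L/2). As
  \<open>k\<close>, 1/\<beta> and exp L are at most twice E = exp H, \<open>Q\<close> is at most a
  fixed power of \<open>E\<close>, and \<open>k * Q ^ d \<le> N\<close> reduces to L^3 H^2 being a
  small multiple of ln N: the definition of \<open>H\<close>.\<close>

lemma progression_in_sumset_large:
  fixes A B C :: "int set" and N k :: nat and \<alpha> \<beta> \<gamma> H L :: real
  defines "\<alpha> \<equiv> card A / N" and "\<beta> \<equiv> card B / N" and "\<gamma> \<equiv> card C / N"
  defines "L \<equiv> ln (2 / (\<alpha> * \<gamma>))"
  defines "H \<equiv> 1 / 10 ^ 6 * sqrt (ln N / L ^ 3)"
  assumes N: "N \<ge> 1"
    and A: "A \<subseteq> {1..int N}" "A \<noteq> {}" and B: "B \<subseteq> {1..int N}" "B \<noteq> {}" and C: "C \<subseteq> {1..int N}" "C \<noteq> {}"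
    and H: "ln 2 \<le> H" and \<alpha>\<gamma>: "\<alpha> * \<gamma> \<le> 1" "1 / (\<alpha> * \<gamma>) \<le> exp H" and \<beta>: "1 / \<beta> \<le> exp H"
    and k: "k > 0" "k \<le> 2 * exp H"
  shows "\<exists>X P. X \<subseteq> B \<and> 0.99 * real (card B) \<le> card X \<and> is_AP P k \<and> X + P \<subseteq> A + B + C"
proof -
  have fin: "finite A" "finite B" "finite C" using A B C finite_subset by blast+
  have cards: "card A > 0" "card B > 0" "card C > 0" using A B C fin by (auto simp: card_gt_0_iff)
  have pos: "\<alpha> > 0" "\<beta> > 0" "\<gamma> > 0" using cards N by (auto simp: \<alpha>_def \<beta>_def \<gamma>_def)
  define E where "E = exp H"
  define y where "y = exp (L / 2)"
  have expL: "exp L = 2 / (\<alpha> * \<gamma>)" using pos by (simp add: L_def)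
  have ysq: "y\<^sup>2 = exp L" by (simp add: y_def power2_eq_square flip: exp_add)
  have "2 \<le> 2 / (\<alpha> * \<gamma>)" using \<alpha>\<gamma> pos by (simp add: field_simps)
  hence y2: "2 \<le> y\<^sup>2" using ysq expL by simp
  have L0: "ln 2 \<le> L" using pos \<open>2 \<le> 2 / (\<alpha> * \<gamma>)\<close> unfolding L_def by (subst ln_le_cancel_iff) auto
  have L_half: "1 / 2 \<le> L" and H_half: "1 / 2 \<le> H" using L0 H ln2_ge_two_thirds by linarith+
  have y1: "1 \<le> y" using L_half by (simp add: y_def)
  have E2: "2 \<le> E" using H unfolding E_def by (metis exp_le_cancel_iff exp_ln zero_less_numeral)
  have E1: "1 \<le> E" using E2 by simp
  have HE: "H \<le> E" unfolding E_def using exp_ge_add_one_self[of H] by linarith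
  have "exp L \<le> 2 * E" using \<alpha>\<gamma>(2) by (simp add: expL E_def)
  also have "\<dots> \<le> E\<^sup>2" using E2 by (simp add: power2_eq_square)
  finally have LE: "exp L \<le> E\<^sup>2" .
  also have "E\<^sup>2 = exp (2 * H)" by (simp add: E_def power2_eq_square flip: exp_add)
  finally have LH: "L \<le> 2 * H" by simp
  have "y \<le> y\<^sup>2" using y1 by (simp add: power2_eq_square)
  hence yE: "y \<le> E\<^sup>2" using ysq LE by simp
  have LH0: "0 < L" "0 < H" using L_half H_half by auto
  have L2H: "1 / 8 \<le> L\<^sup>2 * H"
  proof -
    have "(1 / 2) ^ 2 * (1 / 2) \<le> L\<^sup>2 * H" using L_half H_half by (intro mult_mono power_mono) auto
    thus ?thesis by (simp add: power2_eq_square)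
  qed
  have L3H: "1 / 16 \<le> L ^ 3 * H"
  proof -
    have "(1 / 2) ^ 3 * (1 / 2) \<le> L ^ 3 * H" using L_half H_half by (intro mult_mono power_mono) auto
    thus ?thesis by (simp add: power3_eq_cube)
  qed

  \<comment> \<open>3840000 = 24 * 1600 * 10^2 pairs with \<open>l \<le> 10 * L\<close> to give the
    tail exp (-24 H); 640000000 = 32 * (4 * 4000000 + 4000000) bounds 32 (ln 2 + 4 n L); 260 is
    twice 130 because sqrt a0 = 1/(2 y). Lower bounds on \<open>L\<close> and \<open>H\<close>
    absorb the ceilings.\<close>
  define l where "l = nat \<lceil>8 * L\<rceil>"
  define n where "n = nat \<lceil>3840000 * (L\<^sup>2 * H)\<rceil>"
  define d where "d = nat \<lceil>640000000 * (L ^ 3 * H)\<rceil>"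
  define Q where "Q = nat \<lceil>260 * (real k * d * y)\<rceil>"
  have l: "8 * L \<le> l" "l \<le> 10 * L"
    using nat_ceiling_bounds[of "8 * L"] L_half unfolding l_def by linarith+
  have n: "3840000 * (L\<^sup>2 * H) \<le> n" "n \<le> 4000000 * (L\<^sup>2 * H)"
    using nat_ceiling_bounds[of "3840000 * (L\<^sup>2 * H)"] L2H unfolding n_def by linarith+
  have d: "640000000 * (L ^ 3 * H) \<le> d" "d \<le> 800000000 * (L ^ 3 * H)"
    using nat_ceiling_bounds[of "640000000 * (L ^ 3 * H)"] L3H unfolding d_def by linarith+
  have l0: "l > 0" using l(1) LH0 by (intro Nat.gr0I) auto
  have n1: "1 \<le> real n" using n(1) L2H by linarith
  have d1: "1 \<le> real d" using d(1) L3H by linarith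
  have kdy: "1 \<le> real k * d * y"
    using k(1) d1 y1 by (intro mult_ge1_I) auto
  have Q: "260 * (real k * d * y) \<le> Q" "Q \<le> 261 * (real k * d * y)"
    using nat_ceiling_bounds[of "260 * (real k * d * y)"] kdy unfolding Q_def by linarith+

  define a0 where "a0 = real (card A) * real (card C) / (8 * (real N)\<^sup>2)"
  have a0: "a0 = 1 / (4 * exp L)"
    using N pos unfolding expL by (simp add: a0_def \<alpha>_def \<gamma>_def field_simps power2_eq_square)
  have "a0 = (1 / (2 * y))\<^sup>2" unfolding a0 ysq[symmetric] by (simp add: power_divide power_mult_distrib)
  hence sqrt_a0: "sqrt a0 = 1 / (2 * y)" using y1 by simp

  \<comment> \<open>4^l is at least exp (8 L) = y^16, and y^2 \<ge> 2 makes this exceed 80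
    y.\<close>
  have 1: "40 \<le> 4 ^ l * sqrt a0"
  proof -
    have "128 * y \<le> (y\<^sup>2) ^ 7 * (y * y)"
    proof (rule mult_mono)
      have "2 ^ 7 \<le> (y\<^sup>2) ^ 7" using y2 by (intro power_mono) auto
      thus "128 \<le> (y\<^sup>2) ^ 7" by simp
    qed (use y1 in auto)
    also have "\<dots> = exp (8 * L)"
      by (simp add: y_def power2_eq_square flip: exp_add exp_of_nat_mult)
    also have "\<dots> \<le> exp (real l * 1)" using l(1) by simp
    also have "\<dots> = exp 1 ^ l" by (rule exp_of_nat_mult)
    also have "\<dots> \<le> 4 ^ l" using exp_le by (intro power_mono) auto
    finally show ?thesis using y1 by (simp add: sqrt_a0 field_simps)
  qed
  \<comment> \<open>The exponential is at most E^-24, whereas 32000 k l/\<beta> is at most 1280000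
    E^3; as E \<ge> 2, powers of \<open>E\<close> absorb the constant.\<close>
  have 2: "4 * exp (- (n / (1600 * (real l)\<^sup>2))) \<le> card B / (8000 * real N * k * l)"
  proof -
    have "24 * H * (1600 * (real l)\<^sup>2) \<le> 24 * H * (1600 * (10 * L)\<^sup>2)"
      using l(2) LH0 by (intro mult_left_mono power_mono) auto
    also have "\<dots> = 3840000 * (L\<^sup>2 * H)" by (simp add: power_mult_distrib)
    also note n(1)
    finally have "24 * H \<le> n / (1600 * (real l)\<^sup>2)" using l0 by (simp add: pos_le_divide_eq)
    hence "exp (- (n / (1600 * (real l)\<^sup>2))) \<le> exp (- (24 * H))" by simp
    also have "\<dots> = 1 / E ^ 24" by (simp add: E_def exp_minus inverse_eq_divide flip: exp_of_nat_mult)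
    finally have e: "exp (- (n / (1600 * (real l)\<^sup>2))) \<le> 1 / E ^ 24" .
    have lE: "real l \<le> 20 * E" using l(2) LH HE by linarith
    have "32000 * (real k * l * (1 / \<beta>)) \<le> 32000 * (2 * E * (20 * E) * E)"
      using k lE \<beta> pos E1 by (intro mult_left_mono mult_mono) (auto simp: E_def)
    also have "\<dots> = 1280000 * E ^ 3" by (simp add: power3_eq_cube)
    also have "\<dots> \<le> E ^ 21 * E ^ 3"
    proof (rule mult_right_mono)
      have "2 ^ 21 \<le> E ^ 21" using E2 by (intro power_mono) auto
      thus "1280000 \<le> E ^ 21" by simp
    qed (use E1 in auto)
    also have "\<dots> = E ^ 24" by (simp flip: power_add)
    finally have "32000 * (real k * l * (1 / \<beta>)) \<le> E ^ 24" .
    hence "4 * (1 / E ^ 24) \<le> \<beta> / (8000 * (real k * l))"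
      using E1 k(1) l0 pos by (simp add: field_simps)
    also have "\<dots> = card B / (8000 * real N * k * l)" by (simp add: \<beta>_def)
    finally show ?thesis using e by linarith
  qed
  have 3: "32 * (ln 2 + n * ln (2 / a0)) \<le> d"
  proof -
    have "2 / a0 = 2 ^ 3 * exp L" by (simp add: a0)
    hence "ln (2 / a0) = 3 * ln 2 + L" by (simp only: ln_mult ln_realpow) (simp add: ln_mult)
    also have "\<dots> \<le> 4 * L" using L0 by simp
    finally have le: "ln (2 / a0) \<le> 4 * L" .
    define w where "w = n * ln (2 / a0)"
    define u where "u = n * L"
    have "w \<le> n * (4 * L)" unfolding w_def using le by (intro mult_left_mono) auto
    hence wu: "w \<le> 4 * u" by (simp add: u_def)
    have "1 * L \<le> n * L" using n1 LH0 by (intro mult_right_mono) auto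
    hence Lu: "L \<le> u" by (simp add: u_def)
    have "n * L \<le> 4000000 * (L\<^sup>2 * H) * L" using n(2) LH0 by (intro mult_right_mono) auto
    hence "u \<le> 4000000 * (L ^ 3 * H)" by (simp add: u_def power2_eq_square power3_eq_cube mult_ac)
    hence "32 * ln 2 + 32 * w \<le> d" using wu Lu L0 d(1) by linarith
    thus ?thesis by (simp add: w_def)
  qed
  have 4: "130 * real k * d \<le> Q * sqrt a0"
    using Q(1) y1 by (simp add: sqrt_a0 field_simps)
  \<comment> \<open>With \<open>k\<close> at most E^2 and \<open>Q\<close> at most E^49 the product
    is at most exp (51 d H). The constant 10^-6 in \<open>H\<close> gives d H \<le> ln N / 1250,
    which leaves room for the 51.\<close>
  have 5: "k * Q ^ d \<le> N"
  proof -
    have "L ^ 3 * H \<le> (2 * E) ^ 3 * E"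
      using LH HE LH0 E1 by (intro mult_mono power_mono) auto
    hence dE: "real d \<le> 6400000000 * E ^ 4"
      using d(2) by (simp add: power_mult_distrib eval_nat_numeral)
    have "real Q \<le> 261 * (2 * E * (6400000000 * E ^ 4) * E\<^sup>2)"
    proof (rule order.trans[OF Q(2)])
      show "261 * (real k * d * y) \<le> 261 * (2 * E * (6400000000 * E ^ 4) * E\<^sup>2)"
        using k dE yE y1 E1 by (intro mult_left_mono mult_mono) (auto simp: E_def)
    qed
    also have "\<dots> = 3340800000000 * E ^ 7" by (simp add: eval_nat_numeral)
    also have "\<dots> \<le> E ^ 42 * E ^ 7"
    proof (rule mult_right_mono)
      have "2 ^ 42 \<le> E ^ 42" using E2 by (intro power_mono) auto
      thus "3340800000000 \<le> E ^ 42" by simp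
    qed (use E1 in auto)
    also have "\<dots> = E ^ 49" by (simp flip: power_add)
    finally have QE: "real Q \<le> E ^ 49" .
    have "2 * E \<le> E ^ 2" using E2 by (simp add: power2_eq_square)
    hence kE: "real k \<le> E ^ 2" using k(2) by (simp add: E_def)
    have "real (k * Q ^ d) \<le> E ^ 2 * (E ^ 49) ^ d"
      unfolding of_nat_mult of_nat_power using kE QE E1 by (intro mult_mono power_mono) auto
    also have "\<dots> = E ^ (2 + 49 * d)" by (simp only: power_add power_mult)
    also have "\<dots> \<le> E ^ (51 * d)"
      using E1 d1 by (intro power_increasing) linarith+
    also have "\<dots> = exp (51 * (d * H))"
      by (simp add: E_def flip: exp_of_nat_mult)
    also have "\<dots> \<le> exp (ln N)"
    proof -
      have "d * H \<le> 800000000 * (L ^ 3 * H) * H" using d(2) LH0 by (intro mult_right_mono) auto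
      also have "\<dots> = 800000000 * (L ^ 3 * H\<^sup>2)" by (simp add: power2_eq_square)
      also have "H\<^sup>2 = 1 / 10 ^ 12 * (ln N / L ^ 3)"
        using N LH0 by (simp add: H_def power_mult_distrib power_divide)
      also have "L ^ 3 * (1 / 10 ^ 12 * (ln N / L ^ 3)) = 1 / 10 ^ 12 * ln N" using LH0 by simp
      finally have dH: "d * H \<le> 1 / 1250 * ln N" by simp
      have "0 \<le> ln (real N)" using N by simp
      hence "51 * (d * H) \<le> ln N" using dH by linarith
      thus ?thesis by (simp only: exp_le_cancel_iff)
    qed
    also have "\<dots> = N" using N by simp
    finally show ?thesis by (simp only: of_nat_le_iff)
  qed
  have "0 < real Q" using Q(1) kdy by linarith
  hence "Q > 0" by simp
  moreover have "n > 0" using n1 by simp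
  ultimately show ?thesis
    using progression_in_sumset[OF N A B C k(1) l0 _ _ 1[unfolded a0_def] 2 3[unfolded a0_def] 4[unfolded a0_def] 5] by blast
qed

section \<open>Progressions with one or two terms, and the conclusion\<close>

lemma two_term_AP:
  fixes a b :: int
  assumes "a < b"
  shows "is_AP {a, b} 2"
proof -
  have "{a, b} = {a + int i * (b - a) | i. i < 2}"
    by (auto simp: less_2_cases_iff intro: exI[of _ 0] exI[of _ 1])
  moreover have "b - a > 0" using assms by simp
  ultimately show ?thesis unfolding is_AP_def by blast
qed

lemma one_term_AP: "is_AP {a} 1"
  unfolding is_AP_def by (intro exI[of _ a] exI[of _ 1]) auto

theorem theorem8p4:
  shows "\<exists>c :: real. c > 0 \<and>
    (\<forall>(N :: nat) (A :: int set) (B :: int set) (C :: int set) (\<alpha> :: real) (\<beta> :: real) (\<gamma> :: real).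
      N \<ge> 1 \<longrightarrow>
      A \<subseteq> {1..int N} \<longrightarrow> B \<subseteq> {1..int N} \<longrightarrow> C \<subseteq> {1..int N} \<longrightarrow>
      A \<noteq> {} \<longrightarrow> B \<noteq> {} \<longrightarrow> C \<noteq> {} \<longrightarrow>
      \<alpha> = real (card A) / real N \<longrightarrow>
      \<beta> = real (card B) / real N \<longrightarrow>
      \<gamma> = real (card C) / real N \<longrightarrow>
      (\<exists>(X :: int set) (P :: int set) (k :: nat).
         X \<subseteq> B \<and> real (card X) \<ge> 0.99 * real (card B) \<and>
         is_AP P k \<and>
         real k \<ge> exp (c * sqrt (ln (real N) / (ln (2 / (\<alpha> * \<gamma>))) ^ 3)
                        - ln (1 / (\<alpha> * \<beta> * \<gamma>))) \<and>
         X + P \<subseteq> A + B + C))"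
proof (intro exI[of _ "1 / 10 ^ 6"] conjI allI impI)
  fix N :: nat and A B C :: "int set" and \<alpha> \<beta> \<gamma> :: real
  assume N: "N \<ge> 1" and A: "A \<subseteq> {1..int N}" and B: "B \<subseteq> {1..int N}" and C: "C \<subseteq> {1..int N}"
    and ne: "A \<noteq> {}" "B \<noteq> {}" "C \<noteq> {}"
    and \<alpha>: "\<alpha> = real (card A) / real N" and \<beta>: "\<beta> = real (card B) / real N" and \<gamma>: "\<gamma> = real (card C) / real N"
  define H where "H = 1 / 10 ^ 6 * sqrt (ln (real N) / (ln (2 / (\<alpha> * \<gamma>))) ^ 3)"
  define v where "v = H - ln (1 / (\<alpha> * \<beta> * \<gamma>))"
  have fin: "finite A" "finite B" "finite C" using A B C finite_subset by blast+
  have cards: "card A > 0" "card B > 0" "card C > 0" using ne fin by (auto simp: card_gt_0_iff)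
  have pos: "\<alpha> > 0" "\<beta> > 0" "\<gamma> > 0" using cards N by (auto simp: \<alpha> \<beta> \<gamma>)
  have "card S \<le> N" if "S \<subseteq> {1..int N}" for S using card_mono[OF _ that] by simp
  hence le1: "\<alpha> \<le> 1" "\<beta> \<le> 1" "\<gamma> \<le> 1" using A B C N by (auto simp: \<alpha> \<beta> \<gamma> divide_le_eq)
  have "\<exists>X P k. X \<subseteq> B \<and> real (card X) \<ge> 0.99 * real (card B) \<and> is_AP P k \<and> real k \<ge> exp v \<and> X + P \<subseteq> A + B + C"
  \<comment> \<open>Here the required length is at most 1, and a single translate of
    \<open>B\<close> suffices.\<close>
  proof (cases "v \<le> 0")
    case True
    obtain a c where ac: "a \<in> A" "c \<in> C" using ne by blast
    have "B + {a + c} \<subseteq> A + B + C"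
    proof
      fix x assume "x \<in> B + {a + c}"
      then obtain b where "b \<in> B" "x = a + b + c" by (auto simp: set_plus_def)
      thus "x \<in> A + B + C" using ac by (auto simp: set_plus_def)
    qed
    moreover have "exp v \<le> real 1" using True by simp
    ultimately show ?thesis using one_term_AP[of "a + c"]
      by (intro exI[of _ B] exI[of _ "{a + c}"] exI[of _ 1]) auto
  next
    case v: False
    have ag: "\<alpha> * \<gamma> \<le> 1" and bg: "\<beta> * \<gamma> \<le> 1" using le1 pos by (auto intro!: mult_le_one)
    have "(\<alpha> * \<gamma>) * \<beta> \<le> \<alpha> * \<gamma>" using le1 pos by (intro mult_left_le) auto
    hence abc_ag: "\<alpha> * \<beta> * \<gamma> \<le> \<alpha> * \<gamma>" by (simp add: mult_ac)
    have "\<beta> * (\<alpha> * \<gamma>) \<le> \<beta>" using ag pos by (intro mult_left_le) auto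
    hence abc_b: "\<alpha> * \<beta> * \<gamma> \<le> \<beta>" by (simp add: mult_ac)
    have "\<alpha> * (\<beta> * \<gamma>) \<le> \<alpha>" using bg pos by (intro mult_left_le) auto
    hence abc_a: "\<alpha> * \<beta> * \<gamma> \<le> \<alpha>" by (simp add: mult_ac)
    have abc: "\<alpha> * \<beta> * \<gamma> > 0" using pos by simp
    have "1 \<le> 1 / (\<alpha> * \<beta> * \<gamma>)" using ag abc_ag abc by (simp add: le_divide_eq)
    hence "0 \<le> ln (1 / (\<alpha> * \<beta> * \<gamma>))" by (rule ln_ge_zero)
    hence vH: "v \<le> H" by (simp add: v_def)
    have "ln (1 / (\<alpha> * \<beta> * \<gamma>)) \<le> H" using v by (simp add: v_def)
    hence "exp (ln (1 / (\<alpha> * \<beta> * \<gamma>))) \<le> exp H" by (simp only: exp_le_cancel_iff)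
    hence inv: "1 / (\<alpha> * \<beta> * \<gamma>) \<le> exp H" using abc by (subst (asm) exp_ln) auto
    show ?thesis
    \<comment> \<open>If \<open>H \<le> ln 2\<close>, two terms suffice: v > 0 gives \<alpha> > 1/2
      and excludes \<open>N = 1\<close>, where \<open>H = 0\<close>; so \<open>A\<close> has two
      elements, and their sums with a fixed \<open>c\<close> form the progression.\<close>
    proof (cases "H \<le> ln 2")
      case True
      have expv: "exp v < 2 \<or> exp v = 2"
        using vH True by (metis exp_le_cancel_iff exp_ln less_eq_real_def order.trans zero_less_numeral)
      have N2: "N \<ge> 2"
      proof (rule ccontr)
        assume "\<not> N \<ge> 2"
        hence "N = 1" using N by simp
        hence "H = 0" by (simp add: H_def)
        thus False using v vH by simp
      qed
      have "ln (1 / (\<alpha> * \<beta> * \<gamma>)) < ln 2" using v True by (simp add: v_def)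
      hence "1 / (\<alpha> * \<beta> * \<gamma>) < 2" using abc by (subst (asm) ln_less_cancel_iff) auto
      hence "1 / 2 < \<alpha>" using abc abc_a by (simp add: field_simps)
      hence "N < 2 * real (card A)" using N by (simp add: \<alpha> field_simps)
      hence "card A \<ge> 2" using N2 by linarith
      then obtain a1 a2 where a: "a1 \<in> A" "a2 \<in> A" "a1 < a2"
        by (metis card_le_Suc0_iff_eq fin(1) linorder_neqE not_less_eq_eq numeral_2_eq_2)
      obtain c where c: "c \<in> C" using ne by blast
      have "B + {a1 + c, a2 + c} \<subseteq> A + B + C"
      proof
        fix x assume "x \<in> B + {a1 + c, a2 + c}"
        then obtain b where "b \<in> B" "x = a1 + b + c \<or> x = a2 + b + c" by (auto simp: set_plus_def)
        thus "x \<in> A + B + C" using a c by (auto simp: set_plus_def)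
      qed
      moreover have "is_AP {a1 + c, a2 + c} 2" using a by (intro two_term_AP) auto
      moreover have "exp v \<le> real 2" using expv by auto
      ultimately show ?thesis
        by (intro exI[of _ B] exI[of _ "{a1 + c, a2 + c}"] exI[of _ 2]) auto
    next
      case False
      \<comment> \<open>Rounding up at most doubles exp H, which explains the bound
        \<open>2 * exp H\<close> allowed for \<open>k\<close> in
        \<open>progression_in_sumset_large\<close>.\<close>
      define k where "k = nat \<lceil>exp v\<rceil>"
      have k: "exp v \<le> k" "k \<le> exp v + 1" using nat_ceiling_bounds[of "exp v"] by (auto simp: k_def)
      have "exp v \<le> exp H" using vH by simp
      moreover have "1 \<le> exp H" using v vH by simp
      ultimately have "k \<le> 2 * exp H" using k(2) by linarith
      moreover have "k > 0" using k(1) exp_gt_zero[of v] by (intro Nat.gr0I) auto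
      moreover have "1 / (\<alpha> * \<gamma>) \<le> exp H"
        using abc_ag abc by (intro order.trans[OF _ inv] divide_left_mono) auto
      moreover have "1 / \<beta> \<le> exp H"
        using abc_b abc by (intro order.trans[OF _ inv] divide_left_mono) auto
      ultimately show ?thesis
        using progression_in_sumset_large[OF N A ne(1) B ne(2) C ne(3), of k] False k(1) ag
        unfolding H_def \<alpha> \<beta> \<gamma> by auto
    qed
  qed
  thus "\<exists>X P k. X \<subseteq> B \<and> real (card X) \<ge> 0.99 * real (card B) \<and> is_AP P k \<and>
         real k \<ge> exp (1 / 10 ^ 6 * sqrt (ln (real N) / (ln (2 / (\<alpha> * \<gamma>))) ^ 3) - ln (1 / (\<alpha> * \<beta> * \<gamma>))) \<and>
         X + P \<subseteq> A + B + C"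
    unfolding v_def H_def .
qed simp

end
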